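(* Let $\mathcal{X}$ be the set of probability laws on $\mathbb{R}$ consisting of the standard Gaussian law $\mathcal{N}(0,1)$ together with all centered gamma laws, i.e. the laws of $G_\nu-\nu$, $\nu>0$, where $G_\nu$ has density $\frac{1}{\Gamma(\nu)}x^{\nu-1}e^{-x}\mathbf{1}_{(0,\infty)}(x)$. Let $X=\{X_i\}_{i\ge 1}$ be a sequence of independent random variables such that for every $i\ge 1$ the law of $X_i$ belongs to $\mathcal{X}$. Let $d\ge 1$ and assume that the $d$-th eigenspace $\mathcal{H}_d$ associated with $X$ is hypercontractive (both notions are defined in the context). Let $$P_n(x)=\sum_{i_1<i_2<\cdots<i_d}a_n(i_1,\dots,i_d)\,x_{i_1}\cdots x_{i_d},\qquad n\ge 1,$$ be a sequence of multivariate homogeneous polynomials of degree $d$ with real coefficients (for each $n$ only finitely many coefficients $a_n(i_1,\dots,i_d)$ are nonzero). Then the following two statements are equivalent: (i) As $n\to\infty$, the sequence $\{P_n(X)\}_{n\ge 1}$ converges in distribution to $\mathcal{N}(0,1)$. (ii) As $n\to\infty$, $\mathbb{E}(P_n(X)^2)\to 1$ and $\mathbb{E}(P_n(X)^4)\to 3$.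
   Context: $P_n(X)$ denotes the random variable obtained by substituting $x_i=X_i$. For each $i$, let $(q_{i,k})_{k\ge 0}$ be the sequence of orthogonal polynomials ($\deg q_{i,k}=k$) for the law of $X_i$: Hermite polynomials if $X_i$ is standard Gaussian, and Laguerre polynomials shifted by the mean if $X_i$ is centered gamma. These are the eigenfunctions (with eigenvalue $-k$) of the univariate Ornstein--Uhlenbeck, respectively (shifted) Laguerre, generator having the law of $X_i$ as invariant measure. The $d$-th eigenspace $\mathcal{H}_d$ is the linear span of all finite products $q_{i_1,k_1}(X_{i_1})\cdots q_{i_r,k_r}(X_{i_r})$ with $r\ge 1$, $i_1<\dots<i_r$, $k_1+\dots+k_r=d$ and all $k_j\ge 1$; it is the eigenspace with eigenvalue $-d$ of the tensorized generator. $\mathcal{H}_d$ is called hypercontractive if for every $r\ge 2$ there is a finite constant $C_r$ with $\mathbb{E}(|Y|^r)^{1/r}\le C_r\,\mathbb{E}(Y^2)^{1/2}$ for all $Y\in\mathcal{H}_d$. *)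

theory Defs
  imports "HOL-Probability.Probability" "HOL-Computational_Algebra.Polynomial"
begin

definition gamma_density :: "real \<Rightarrow> real \<Rightarrow> real" where
  "gamma_density \<nu> x = (if 0 < x then x powr (\<nu> - 1) * exp (- x) / Gamma \<nu> else 0)"

definition centered_gamma_distribution :: "real \<Rightarrow> real measure" where
  "centered_gamma_distribution \<nu> =
     distr (density lborel (\<lambda>x. ennreal (gamma_density \<nu> x))) borel (\<lambda>x. x - \<nu>)"

definition gaussian_gamma_laws :: "real measure set" where
  "gaussian_gamma_laws =
     {std_normal_distribution} \<union> {centered_gamma_distribution \<nu> |\<nu>. 0 < \<nu>}"

text \<open>
  The condition \<open>q k \<noteq> 0\<close> matters for \<open>k = 0\<close> only, since the zero polynomial also has degree 0.
  For a law of infinite support with finite moments, \<open>q k\<close> is determined up to a nonzero factor.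
\<close>
definition orthogonal_polynomials :: "real measure \<Rightarrow> (nat \<Rightarrow> real poly) \<Rightarrow> bool" where
  "orthogonal_polynomials \<mu> q \<longleftrightarrow>
     (\<forall>k. q k \<noteq> 0 \<and> degree (q k) = k) \<and>
     (\<forall>j k. integrable \<mu> (\<lambda>x. poly (q j) x * poly (q k) x)) \<and>
     (\<forall>j k. j \<noteq> k \<longrightarrow> (\<integral>x. poly (q j) x * poly (q k) x \<partial>\<mu>) = 0)"

text \<open>
  The Hermite polynomials and the Laguerre polynomials shifted by the mean are eigenfunctions, with
  eigenvalue \<open>- k\<close>, of the respective generators, hence orthogonal for the laws considered here.
\<close>
definition hermite :: "nat \<Rightarrow> real poly" where
  "hermite k = ((\<lambda>p. [:0, 1:] * p - pderiv p) ^^ k) 1"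

definition laguerre :: "real \<Rightarrow> nat \<Rightarrow> real poly" where
  "laguerre \<alpha> k = (\<Sum>j\<le>k. monom ((-1) ^ j * ((real k + \<alpha>) gchoose (k - j)) / fact j) j)"

definition shifted_laguerre :: "real \<Rightarrow> nat \<Rightarrow> real poly" where
  "shifted_laguerre \<nu> k = pcompose (laguerre (\<nu> - 1) k) [:\<nu>, 1:]"

text \<open>
  The operator \<open>\<tau> * p'' - x * p'\<close> is the Ornstein--Uhlenbeck generator for \<open>\<tau> = 1\<close> and the shifted
  Laguerre generator for \<open>\<tau> = x + \<nu>\<close>; assumption \<open>ibp\<close> makes it symmetric with respect to \<open>\<mu>\<close>.
\<close>
lemma orthogonal_polynomials_eigen:
  fixes \<tau> :: "real poly"
  assumes int: "\<And>p. integrable \<mu> (poly p)"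
    and ibp: "\<And>p. (\<integral>x. poly (\<tau> * pderiv p - [:0, 1:] * p) x \<partial>\<mu>) = 0"
    and deg: "\<And>k. q k \<noteq> 0" "\<And>k. degree (q k) = k"
    and eig: "\<And>k. \<tau> * pderiv (pderiv (q k)) - [:0, 1:] * pderiv (q k) = smult (- real k) (q k)"
  shows "orthogonal_polynomials \<mu> q"
proof -
  have E: "(\<integral>x. poly (\<tau> * pderiv p * pderiv r) x \<partial>\<mu>) = real k * (\<integral>x. poly (p * r) x \<partial>\<mu>)"
    if "p = q k" for k p r
  proof -
    have "\<tau> * pderiv (pderiv p * r) - [:0, 1:] * (pderiv p * r)
        = (\<tau> * pderiv (pderiv p) - [:0, 1:] * pderiv p) * r + \<tau> * pderiv p * pderiv r"
      by (simp add: pderiv_mult algebra_simps)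
    also have "\<dots> = smult (- real k) (p * r) + \<tau> * pderiv p * pderiv r"
      by (simp only: that eig mult_smult_left)
    finally have "0 = (\<integral>x. poly (smult (- real k) (p * r) + \<tau> * pderiv p * pderiv r) x \<partial>\<mu>)"
      using ibp[of "pderiv p * r"] by simp
    also have "\<dots> = (\<integral>x. (- real k) * poly (p * r) x + poly (\<tau> * pderiv p * pderiv r) x \<partial>\<mu>)"
      by simp
    also have "\<dots> = - real k * (\<integral>x. poly (p * r) x \<partial>\<mu>) + (\<integral>x. poly (\<tau> * pderiv p * pderiv r) x \<partial>\<mu>)"
      by (subst Bochner_Integration.integral_add)
         (auto simp del: poly_mult intro!: integrable_mult_right int)
    finally show ?thesis by simp
  qed
  have "(\<integral>x. poly (q j) x * poly (q k) x \<partial>\<mu>) = 0" if "j \<noteq> k" for j k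
  proof -
    have "real j * (\<integral>x. poly (q j * q k) x \<partial>\<mu>) = real k * (\<integral>x. poly (q j * q k) x \<partial>\<mu>)"
      using E[of "q j" j "q k"] E[of "q k" k "q j"] by (simp only: mult.commute mult.left_commute)
    with that show ?thesis by simp
  qed
  moreover have "integrable \<mu> (\<lambda>x. poly (q j) x * poly (q k) x)" for j k
    using int[of "q j * q k"] by (simp add: poly_mult[abs_def])
  ultimately show ?thesis
    using deg by (simp add: orthogonal_polynomials_def)
qed

lemma poly_moments:
  fixes \<mu> :: "real measure"
  assumes "\<And>n. integrable \<mu> (\<lambda>x. x ^ n)"
  shows "integrable \<mu> (poly p)"
    and "\<lbrakk>\<And>n. (\<integral>x. poly (\<sigma> * pderiv (monom 1 n) - \<rho> * monom 1 n) x \<partial>\<mu>) = 0\<rbrakk>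
           \<Longrightarrow> (\<integral>x. poly (\<sigma> * pderiv p - \<rho> * p) x \<partial>\<mu>) = 0"
proof -
  show int: "integrable \<mu> (poly p)" for p
    using assms by (auto simp: poly_altdef[abs_def])
  assume *: "\<And>n. (\<integral>x. poly (\<sigma> * pderiv (monom 1 n) - \<rho> * monom 1 n) x \<partial>\<mu>) = 0"
  define T where "T p = \<sigma> * pderiv p - \<rho> * p" for p
  have T_sum: "T (\<Sum>i\<le>n. smult (c i) (f i)) = (\<Sum>i\<le>n. smult (c i) (T (f i)))" for n :: nat and c f
    by (induction n) (simp_all add: T_def pderiv_add pderiv_smult algebra_simps smult_diff_right)
  have "p = (\<Sum>i\<le>degree p. smult (coeff p i) (monom 1 i))"
    by (simp add: smult_monom poly_as_sum_of_monoms)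
  then have "T p = (\<Sum>i\<le>degree p. smult (coeff p i) (T (monom 1 i)))"
    using T_sum by metis
  then have "(\<integral>x. poly (T p) x \<partial>\<mu>) = (\<integral>x. (\<Sum>i\<le>degree p. coeff p i * poly (T (monom 1 i)) x) \<partial>\<mu>)"
    by (simp add: poly_sum)
  also have "\<dots> = (\<Sum>i\<le>degree p. coeff p i * (\<integral>x. poly (T (monom 1 i)) x \<partial>\<mu>))"
    by (subst Bochner_Integration.integral_sum) (auto intro!: integrable_mult_right int)
  also have "\<dots> = 0" using * by (simp add: T_def)
  finally show "(\<integral>x. poly (\<sigma> * pderiv p - \<rho> * p) x \<partial>\<mu>) = 0" by (simp add: T_def)
qed

lemma hermite_Suc: "hermite (Suc k) = [:0, 1:] * hermite k - pderiv (hermite k)"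
  by (simp add: hermite_def)

lemma pderiv_hermite: "pderiv (hermite (Suc k)) = smult (real (Suc k)) (hermite k)"
proof (induction k)
  case 0
  show ?case by (simp add: hermite_def pderiv_pCons)
next
  case (Suc k)
  have "pderiv (hermite (Suc (Suc k)))
      = hermite (Suc k) + [:0, 1:] * pderiv (hermite (Suc k)) - pderiv (pderiv (hermite (Suc k)))"
    by (subst hermite_Suc) (simp add: pderiv_diff pderiv_mult pderiv_pCons)
  also have "\<dots> = hermite (Suc k) + smult (real (Suc k)) ([:0, 1:] * hermite k - pderiv (hermite k))"
    unfolding Suc by (simp add: pderiv_smult smult_diff_right algebra_simps)
  also have "\<dots> = smult (real (Suc (Suc k))) (hermite (Suc k))"
    unfolding hermite_Suc[of k, symmetric] by (rule poly_eqI) (simp add: algebra_simps)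
  finally show ?case .
qed

lemma degree_hermite: "hermite k \<noteq> 0 \<and> degree (hermite k) = k"
proof (induction k)
  case 0
  show ?case by (simp add: hermite_def)
next
  case (Suc k)
  have "degree ([:0, 1:] * hermite k) = Suc k" using Suc by (simp add: degree_mult_eq)
  moreover have "degree (pderiv (hermite k)) < Suc k" using Suc by (simp add: degree_pderiv)
  ultimately have "degree (hermite (Suc k)) = Suc k"
    unfolding hermite_Suc by (metis degree_add_eq_left degree_minus diff_conv_add_uminus)
  then show ?case by force
qed

lemma std_normal_moments:
  "integrable std_normal_distribution (\<lambda>x. x ^ n)"
  "(\<integral>x. x ^ Suc (Suc n) \<partial>std_normal_distribution) = real (Suc n) * (\<integral>x. x ^ n \<partial>std_normal_distribution)"
proof -
  show "integrable std_normal_distribution (\<lambda>x. x ^ n)"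
    using integrable_std_normal_moment[of n] by (simp add: integrable_density)
  show "(\<integral>x. x ^ Suc (Suc n) \<partial>std_normal_distribution) = real (Suc n) * (\<integral>x. x ^ n \<partial>std_normal_distribution)"
  proof (cases "even n")
    case True
    then obtain k where n: "n = 2 * k" by (elim evenE)
    have "fact (2 * Suc k) / (2 ^ Suc k * fact (Suc k))
        = real (Suc (2 * k)) * (fact (2 * k) / (2 ^ k * fact k) :: real)"
      by (simp add: divide_simps)
    then have "(\<integral>x. std_normal_density x * x ^ (2 * Suc k) \<partial>lborel)
        = real (Suc n) * (\<integral>x. std_normal_density x * x ^ n \<partial>lborel)"
      unfolding n integral_std_normal_moment_even .
    then show ?thesis by (simp add: integral_density n)
  next
    case False
    then obtain k where "n = 2 * k + 1" by (elim oddE)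
    then show ?thesis
      using integral_std_normal_moment_odd[of k] integral_std_normal_moment_odd[of "Suc k"]
      by (simp add: integral_density field_simps)
  qed
qed

lemma orthogonal_polynomials_hermite:
  "orthogonal_polynomials std_normal_distribution hermite"
proof (rule orthogonal_polynomials_eigen)
  show "integrable std_normal_distribution (poly p)" for p
    by (rule poly_moments(1)[OF std_normal_moments(1)])
  show "(\<integral>x. poly (1 * pderiv p - [:0, 1:] * p) x \<partial>std_normal_distribution) = 0" for p
  proof (rule poly_moments(2)[OF std_normal_moments(1)])
    fix n
    show "(\<integral>x. poly (1 * pderiv (monom 1 n) - [:0, 1:] * monom 1 n) x \<partial>std_normal_distribution) = 0"
    proof (cases n)
      case 0
      then show ?thesis
        using integral_std_normal_moment_odd[of 0] by (simp add: integral_density pderiv_monom poly_monom)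
    next
      case (Suc m)
      have "(\<integral>x. poly (1 * pderiv (monom 1 n) - [:0, 1:] * monom 1 n) x \<partial>std_normal_distribution)
          = (\<integral>x. real (Suc m) * x ^ m - x ^ Suc (Suc m) \<partial>std_normal_distribution)"
        by (simp add: Suc pderiv_monom poly_monom)
      also have "\<dots> = 0"
        using std_normal_moments(1)[of m] std_normal_moments(1)[of "Suc (Suc m)"] std_normal_moments(2)[of m]
        by (subst Bochner_Integration.integral_diff) auto
      finally show ?thesis .
    qed
  qed
  show "1 * pderiv (pderiv (hermite k)) - [:0, 1:] * pderiv (hermite k) = smult (- real k) (hermite k)" for k
  proof (cases k)
    case (Suc m)
    show ?thesis
      unfolding Suc pderiv_hermite by (rule poly_eqI) (simp add: pderiv_smult hermite_Suc[of m] coeff_pCons algebra_simps split: nat.split)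
  qed (simp add: hermite_def)
qed (use degree_hermite in auto)

lemma gamma_moment:
  assumes "0 < \<nu>"
  shows "has_bochner_integral (density lborel (\<lambda>x. ennreal (gamma_density \<nu> x))) (\<lambda>x. x ^ n)
           (Gamma (\<nu> + real n) / Gamma \<nu>)"
proof -
  have G: "Gamma \<nu> > 0" "Gamma (\<nu> + real n) > 0" using assms by (auto intro!: Gamma_real_pos)
  have m [measurable]: "gamma_density \<nu> \<in> borel_measurable borel"
    unfolding gamma_density_def[abs_def] by measurable
  have "has_bochner_integral lborel (\<lambda>t. indicator {0..} t * t powr (\<nu> + real n - 1) / exp t) (Gamma (\<nu> + real n))"
    using G Gamma_conv_nn_integral_real[of "\<nu> + real n"] assms
    by (intro has_bochner_integral_nn_integral) auto
  from has_bochner_integral_mult_right[OF this, of "inverse (Gamma \<nu>)"]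
  have "has_bochner_integral lborel (\<lambda>t. inverse (Gamma \<nu>) * (indicator {0..} t * t powr (\<nu> + real n - 1) / exp t))
          (Gamma (\<nu> + real n) / Gamma \<nu>)"
    by (simp add: divide_inverse mult.commute)
  moreover have "inverse (Gamma \<nu>) * (indicator {0..} t * t powr (\<nu> + real n - 1) / exp t)
      = gamma_density \<nu> t *\<^sub>R t ^ n" for t
  proof (cases "t > 0")
    case True
    have "t powr (\<nu> + real n - 1) = t powr (\<nu> - 1) * t ^ n"
      using True by (simp add: powr_add[symmetric] powr_realpow[symmetric] algebra_simps)
    then show ?thesis using True by (simp add: gamma_density_def exp_minus field_simps)
  qed (auto simp: gamma_density_def indicator_def)
  ultimately show ?thesis
    using G by (intro has_bochner_integral_density) (auto simp: gamma_density_def)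
qed


lemma coeff_laguerre:
  "coeff (laguerre \<alpha> k) j
     = (if j \<le> k then (-1) ^ j * ((real k + \<alpha>) gchoose (k - j)) / fact j else 0)"
  by (simp add: laguerre_def coeff_sum)

lemma laguerre_eigen:
  "[:0, 1:] * pderiv (pderiv (laguerre (\<nu> - 1) k)) - [:- \<nu>, 1:] * pderiv (laguerre (\<nu> - 1) k)
     = smult (- real k) (laguerre (\<nu> - 1) k)" (is "?l = ?r")
proof (rule poly_eqI)
  fix j
  let ?c = "coeff (laguerre (\<nu> - 1) k)"
  have *: "real (Suc j) * (real j + \<nu>) * ?c (Suc j) = (real j - real k) * ?c j"
  proof (cases "j < k")
    case True
    define m where "m = k - Suc j"
    have k: "k = Suc (j + m)" using True by (simp add: m_def)
    have "real (Suc m) * ((real k + (\<nu> - 1)) gchoose Suc m)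
        = (real j + \<nu>) * ((real k + (\<nu> - 1)) gchoose m)"
      using gbinomial_absorb_comp[of "real k + (\<nu> - 1)" m] gbinomial_absorption[of m "real k + (\<nu> - 1)"]
      by (simp add: k algebra_simps)
    moreover have "- (v * (e * B)) = (- 1 - u) * (e * A)" if "(1 + u) * A = v * B" for u v e A B :: real
      using arg_cong[OF that, of "\<lambda>t. - e * t"] by (simp add: algebra_simps)
    ultimately show ?thesis
      by (simp add: coeff_laguerre k divide_simps)
  qed (auto simp: coeff_laguerre)
  show "coeff ?l j = coeff ?r j"
    using * by (cases j) (simp_all add: coeff_pderiv algebra_simps)
qed

lemma orthogonal_polynomials_shifted_laguerre:
  assumes "0 < \<nu>"
  shows "orthogonal_polynomials (centered_gamma_distribution \<nu>) (shifted_laguerre \<nu>)"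
proof (rule orthogonal_polynomials_eigen)
  let ?G = "density lborel (\<lambda>x. ennreal (gamma_density \<nu> x))"
  let ?s = "[:- \<nu>, 1:]"
  have m [measurable]: "poly p \<in> borel_measurable borel" for p :: "real poly"
    by (intro borel_measurable_continuous_onI continuous_intros)
  have int: "integrable ?G (\<lambda>x. x ^ n)" for n
    using gamma_moment[OF assms] by (auto simp: has_bochner_integral_iff)
  have shift: "poly p (x - \<nu>) = poly (pcompose p ?s) x" for p x
    by (simp add: poly_pcompose)
  show "integrable (centered_gamma_distribution \<nu>) (poly p)" for p
    unfolding centered_gamma_distribution_def
    by (subst integrable_distr_eq) (simp_all only: shift, auto intro!: poly_moments int)
  have Gamma_Suc: "Gamma (\<nu> + real (Suc n)) = (\<nu> + real n) * Gamma (\<nu> + real n)" for n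
    using Gamma_plus1[of "\<nu> + real n"] assms by (auto simp: add_ac nonpos_Ints_def)
  have "(\<integral>x. poly ([:0, 1:] * pderiv p - ?s * p) x \<partial>?G) = 0" for p
  proof (rule poly_moments(2)[OF int])
    fix n
    have "poly ([:0, 1:] * pderiv (monom 1 n) - ?s * monom 1 n) x = (\<nu> + real n) * x ^ n - x ^ Suc n" for x
      by (cases n) (simp_all add: pderiv_monom poly_monom algebra_simps)
    then have "(\<integral>x. poly ([:0, 1:] * pderiv (monom 1 n) - ?s * monom 1 n) x \<partial>?G)
        = (\<nu> + real n) * (\<integral>x. x ^ n \<partial>?G) - (\<integral>x. x ^ Suc n \<partial>?G)"
      using int[of n] int[of "Suc n"] by (simp del: power_Suc)
    also have "\<dots> = 0"
      using has_bochner_integral_integral_eq[OF gamma_moment[OF assms]] Gamma_Suc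
      by (simp del: power_Suc of_nat_Suc)
    finally show "(\<integral>x. poly ([:0, 1:] * pderiv (monom 1 n) - ?s * monom 1 n) x \<partial>?G) = 0" .
  qed
  note ibp = this
  show "(\<integral>x. poly ([:\<nu>, 1:] * pderiv p - [:0, 1:] * p) x \<partial>centered_gamma_distribution \<nu>) = 0" for p
  proof -
    have "pcompose ([:\<nu>, 1:] * pderiv p - [:0, 1:] * p) ?s
        = [:0, 1:] * pderiv (pcompose p ?s) - ?s * pcompose p ?s"
      by (simp only: pcompose_diff pcompose_mult pderiv_pcompose) (simp add: pcompose_pCons pderiv_pCons)
    then show ?thesis
      unfolding centered_gamma_distribution_def
      using ibp[of "pcompose p ?s"] by (subst integral_distr) (simp_all only: shift, auto)
  qed
  have "degree (laguerre (\<nu> - 1) k) = k" for k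
  proof (rule antisym)
    show "degree (laguerre (\<nu> - 1) k) \<le> k" by (rule degree_le) (simp add: coeff_laguerre)
    show "k \<le> degree (laguerre (\<nu> - 1) k)" by (rule le_degree) (simp add: coeff_laguerre)
  qed
  then show "degree (shifted_laguerre \<nu> k) = k" for k
    by (simp add: shifted_laguerre_def degree_pcompose)
  have "coeff (laguerre (\<nu> - 1) k) k \<noteq> 0" for k by (simp add: coeff_laguerre)
  then have "laguerre (\<nu> - 1) k \<noteq> 0" for k by (metis coeff_0)
  then show "shifted_laguerre \<nu> k \<noteq> 0" for k
    by (simp add: shifted_laguerre_def pcompose_eq_0_iff)
  show "[:\<nu>, 1:] * pderiv (pderiv (shifted_laguerre \<nu> k)) - [:0, 1:] * pderiv (shifted_laguerre \<nu> k)
      = smult (- real k) (shifted_laguerre \<nu> k)" for k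
    using arg_cong[OF laguerre_eigen[of \<nu> k], of "\<lambda>p. pcompose p [:\<nu>, 1:]"]
    by (simp only: shifted_laguerre_def pcompose_diff pcompose_mult pcompose_smult pderiv_pcompose)
       (simp add: pcompose_pCons pderiv_mult pderiv_pcompose pderiv_pCons)
qed

text \<open>
  The set \<open>I\<close> below consists of the indices $i_1 < \dots < i_r$, and \<open>k\<close> maps each $i_j$ to $k_j$.
\<close>
definition eigen_products ::
    "(nat \<Rightarrow> nat \<Rightarrow> real poly) \<Rightarrow> (nat \<Rightarrow> 'a \<Rightarrow> real) \<Rightarrow> nat \<Rightarrow> ('a \<Rightarrow> real) set" where
  "eigen_products q X d =
     {(\<lambda>\<omega>. \<Prod>i\<in>I. poly (q i (k i)) (X i \<omega>)) |I k.
        finite I \<and> I \<noteq> {} \<and> (\<forall>i\<in>I. 1 \<le> k i) \<and> (\<Sum>i\<in>I. k i) = d}"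

definition eigenspace ::
    "(nat \<Rightarrow> nat \<Rightarrow> real poly) \<Rightarrow> (nat \<Rightarrow> 'a \<Rightarrow> real) \<Rightarrow> nat \<Rightarrow> ('a \<Rightarrow> real) set" where
  "eigenspace q X d =
     {(\<lambda>\<omega>. \<Sum>Z\<in>F. c Z * Z \<omega>) |F c. finite F \<and> F \<subseteq> eigen_products q X d}"

definition hypercontractive :: "'a measure \<Rightarrow> ('a \<Rightarrow> real) set \<Rightarrow> bool" where
  "hypercontractive M H \<longleftrightarrow>
     (\<forall>r::real. 2 \<le> r \<longrightarrow> (\<exists>C::real. \<forall>Y\<in>H.
        integrable M (\<lambda>\<omega>. \<bar>Y \<omega>\<bar> powr r) \<and>
        (\<integral>\<omega>. \<bar>Y \<omega>\<bar> powr r \<partial>M) powr (1 / r) \<le> C * sqrt (\<integral>\<omega>. (Y \<omega>)\<^sup>2 \<partial>M)))"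

definition increasing_tuples :: "nat \<Rightarrow> nat list set" where
  "increasing_tuples d = {is. length is = d \<and> sorted_wrt (<) is}"

text \<open>
  The value at \<open>x\<close> of $\sum_{i_1 < \dots < i_d} a(i_1, \dots, i_d)\, x_{i_1} \cdots x_{i_d}$; the
  sum ranges over the support of \<open>a\<close>, because \<^const>\<open>sum\<close> is 0 on an infinite set.
\<close>
definition homogeneous_sum :: "nat \<Rightarrow> (nat list \<Rightarrow> real) \<Rightarrow> (nat \<Rightarrow> real) \<Rightarrow> real" where
  "homogeneous_sum d a x =
     (\<Sum>is\<in>{is \<in> increasing_tuples d. a is \<noteq> 0}. a is * (\<Prod>i\<leftarrow>is. x i))"

end

theory Submission
  imports Defs "HOL-Real_Asymp.Real_Asymp"
begin

text \<open>
  Convergence in distribution is obtained from the second and fourth moments by Stein's method. Both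
  kinds of laws satisfy an integration by parts formula \<open>E[X g(X)] = E[\<tau>(X) g'(X)]\<close> with an affine
  weight \<open>\<tau>(x) = s x + v\<close>, namely \<open>\<tau> = 1\<close> for the Gaussian and \<open>\<tau>(x) = x + \<nu>\<close> for the centered gamma
  law. The form \<open>F = P(X)\<close> is affine in each variable and homogeneous of degree \<open>d\<close>, so conditioning on
  all variables but one and summing with Euler's identity gives
  \<open>d E[F \<phi>(F)] = E[\<Gamma> \<phi>'(F)]\<close>, where \<open>\<Gamma> = \<Sum> \<tau>\<^sub>i(X\<^sub>i) (\<partial>\<^sub>iP)\<^sup>2\<close> is the carre du champ of \<open>F\<close>
  (\<open>integration_by_parts\<close>). With \<open>\<phi>(x) = cos (t x)\<close> or \<open>sin (t x)\<close> this is an approximate form of the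
  differential equation \<open>u' = - t u\<close> satisfied by the Gaussian characteristic function, with an error
  controlled by the distance of \<open>\<Gamma> / d\<close> from 1 in mean square (\<open>stein_kernel_clt\<close>).

  It remains to control that distance by the fourth moment. The polynomial \<open>F\<^sup>2\<close> has degree at most
  \<open>2 d\<close>, hence is a sum of eigenfunctions of the generator \<open>L\<close> with eigenvalues \<open>- m\<close>, \<open>0 \<le> m \<le> 2 d\<close>, and
  \<open>\<Gamma> = (L + 2 d) F\<^sup>2 / 2\<close>. Thus, in an orthogonal expansion, \<open>\<Gamma>\<close> and \<open>d F\<^sup>2 - \<Gamma>\<close> arise from \<open>F\<^sup>2\<close> by
  multiplying each component by the nonnegative numbers \<open>d - m / 2\<close> and \<open>m / 2\<close>, which yields
  \<open>E[\<Gamma> (d F\<^sup>2 - \<Gamma>)] \<ge> 0\<close> (\<open>spectral_inequality\<close>). Integration by parts with \<open>\<phi>(x) = x\<^sup>3\<close> evaluates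
  \<open>E[\<Gamma> F\<^sup>2] = d E[F\<^sup>4] / 3\<close>, and therefore \<open>E[(\<Gamma> / d - 1)\<^sup>2] \<le> E[F\<^sup>4] / 3 - 2 E[F\<^sup>2] + 1\<close>
  (\<open>stein_kernel_variance\<close>), whose right-hand side tends to 0 when the moments tend to 1 and 3.

  For the converse, hypercontractivity bounds the fourth and eighth moments of \<open>F\<close> by powers of the
  second. A Paley--Zygmund argument shows that the second moments of a tight sequence of this kind are
  bounded (\<open>weak_conv_second_moment_bounded\<close>); then \<open>F\<^sup>2\<close> and \<open>F\<^sup>4\<close> are uniformly integrable and their
  expectations converge along with the laws (\<open>weak_conv_integral_conv\<close>).
\<close>

section \<open>Stein identities for the Gaussian and gamma laws\<close>

text \<open>
  A growth condition that covers the test functions used below, \<open>x\<close>, \<open>x\<^sup>3\<close> and the bounded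
  trigonometric functions, together with their derivatives.
\<close>
definition cubic_growth :: "(real \<Rightarrow> real) \<Rightarrow> bool" where
  "cubic_growth g \<longleftrightarrow> (\<exists>C. \<forall>x. \<bar>g x\<bar> \<le> C * (1 + \<bar>x\<bar>) ^ 3)"

text \<open>
  The affine function \<open>s x + v\<close> is the Stein kernel of \<open>\<mu>\<close>, that is, the coefficient of the second
  derivative in the diffusion generator \<open>(s x + v) f'' - x f'\<close> that has \<open>\<mu>\<close> as invariant law.
\<close>
definition stein_law :: "real measure \<Rightarrow> real \<Rightarrow> real \<Rightarrow> bool" where
  "stein_law \<mu> s v \<longleftrightarrow>
     (\<forall>n. integrable \<mu> (\<lambda>x. x ^ n)) \<and>
     (\<forall>g g'. (\<forall>x. (g has_real_derivative g' x) (at x)) \<longrightarrow> continuous_on UNIV g' \<longrightarrow>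
        cubic_growth g \<longrightarrow> cubic_growth g' \<longrightarrow>
        (\<integral>x. x * g x \<partial>\<mu>) = (\<integral>x. (s * x + v) * g' x \<partial>\<mu>))"

lemma cubic_growth_pos:
  assumes "cubic_growth g"
  obtains C where "C > 0" "\<And>x. \<bar>g x\<bar> \<le> C * (1 + \<bar>x\<bar>) ^ 3"
proof -
  from assms obtain C where C: "\<And>x. \<bar>g x\<bar> \<le> C * (1 + \<bar>x\<bar>) ^ 3"
    by (auto simp: cubic_growth_def)
  have "\<bar>g x\<bar> \<le> (\<bar>C\<bar> + 1) * (1 + \<bar>x\<bar>) ^ 3" for x
    using C[of x] by (rule order_trans) (intro mult_right_mono, auto)
  then show ?thesis by (intro that[of "\<bar>C\<bar> + 1"]) auto
qed

lemma cubic_growth_affine: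
  assumes "cubic_growth g"
  shows "cubic_growth (\<lambda>x. \<gamma> * g (\<alpha> * x + \<beta>))"
proof -
  obtain C where C: "C > 0" "\<And>x. \<bar>g x\<bar> \<le> C * (1 + \<bar>x\<bar>) ^ 3"
    using cubic_growth_pos[OF assms] by blast
  have "\<bar>\<gamma> * g (\<alpha> * x + \<beta>)\<bar> \<le> (\<bar>\<gamma>\<bar> * C * (1 + \<bar>\<alpha>\<bar> + \<bar>\<beta>\<bar>) ^ 3) * (1 + \<bar>x\<bar>) ^ 3" for x
  proof -
    have "1 + \<bar>\<alpha> * x + \<beta>\<bar> \<le> (1 + \<bar>\<alpha>\<bar> + \<bar>\<beta>\<bar>) * (1 + \<bar>x\<bar>)"
    proof -
      have "\<bar>\<alpha> * x + \<beta>\<bar> \<le> \<bar>\<alpha>\<bar> * \<bar>x\<bar> + \<bar>\<beta>\<bar>"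
        by (metis abs_mult abs_triangle_ineq)
      moreover have "0 \<le> \<bar>\<beta>\<bar> * \<bar>x\<bar>" "0 \<le> \<bar>\<alpha>\<bar>" by simp_all
      ultimately show ?thesis unfolding ring_distribs by linarith
    qed
    then have "(1 + \<bar>\<alpha> * x + \<beta>\<bar>) ^ 3 \<le> ((1 + \<bar>\<alpha>\<bar> + \<bar>\<beta>\<bar>) * (1 + \<bar>x\<bar>)) ^ 3"
      by (intro power_mono) auto
    then have "C * (1 + \<bar>\<alpha> * x + \<beta>\<bar>) ^ 3 \<le> C * ((1 + \<bar>\<alpha>\<bar> + \<bar>\<beta>\<bar>) * (1 + \<bar>x\<bar>)) ^ 3"
      using C(1) by (intro mult_left_mono) auto
    with C(2)[of "\<alpha> * x + \<beta>"]
    have "\<bar>g (\<alpha> * x + \<beta>)\<bar> \<le> C * ((1 + \<bar>\<alpha>\<bar> + \<bar>\<beta>\<bar>) * (1 + \<bar>x\<bar>)) ^ 3"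
      by linarith
    then have "\<bar>\<gamma>\<bar> * \<bar>g (\<alpha> * x + \<beta>)\<bar> \<le> \<bar>\<gamma>\<bar> * (C * ((1 + \<bar>\<alpha>\<bar> + \<bar>\<beta>\<bar>) * (1 + \<bar>x\<bar>)) ^ 3)"
      by (intro mult_left_mono) auto
    then show ?thesis by (simp add: abs_mult power_mult_distrib mult_ac)
  qed
  then show ?thesis unfolding cubic_growth_def by blast
qed

lemma cubic_growth_bounded:
  assumes "\<And>x. \<bar>g x\<bar> \<le> B"
  shows "cubic_growth g"
proof -
  have "\<bar>g x\<bar> \<le> B * (1 + \<bar>x\<bar>) ^ 3" for x
  proof -
    have "0 \<le> B" using assms[of x] by linarith
    then have "B * 1 \<le> B * (1 + \<bar>x\<bar>) ^ 3" by (intro mult_left_mono one_le_power) auto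
    then show ?thesis using assms[of x] by linarith
  qed
  then show ?thesis unfolding cubic_growth_def by blast
qed

lemma cubic_growth_monomial:
  assumes "k \<le> 3"
  shows "cubic_growth (\<lambda>x. a * x ^ k)"
proof -
  have "\<bar>a * x ^ k\<bar> \<le> \<bar>a\<bar> * (1 + \<bar>x\<bar>) ^ 3" for x
  proof -
    have "\<bar>x\<bar> ^ k \<le> (1 + \<bar>x\<bar>) ^ k" by (intro power_mono) auto
    also have "\<dots> \<le> (1 + \<bar>x\<bar>) ^ 3" using assms by (intro power_increasing) auto
    finally show ?thesis by (simp add: abs_mult power_abs mult_left_mono)
  qed
  then show ?thesis unfolding cubic_growth_def by blast
qed

lemma integrable_polynomial_growth:
  fixes \<mu> :: "real measure"
  assumes mom: "\<And>n. integrable \<mu> (\<lambda>x. x ^ n)" and [measurable]: "h \<in> borel_measurable \<mu>"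
    and bound: "\<And>x. \<bar>h x\<bar> \<le> C * (1 + \<bar>x\<bar>) ^ m"
  shows "integrable \<mu> h"
proof (rule Bochner_Integration.integrable_bound)
  show "integrable \<mu> (poly (smult \<bar>C\<bar> ([:2, 0, 2:] ^ m)))"
    by (rule poly_moments(1)[OF mom])
  show "h \<in> borel_measurable \<mu>" by fact
  show "AE x in \<mu>. norm (h x) \<le> norm (poly (smult \<bar>C\<bar> ([:2, 0, 2:] ^ m)) x)"
  proof (rule AE_I2)
    fix x :: real
    have "1 + \<bar>x\<bar> \<le> 2 + x * (x * 2)"
    proof -
      have "0 \<le> (\<bar>x\<bar> - 1)\<^sup>2" "0 \<le> x\<^sup>2" by simp_all
      then have "2 * \<bar>x\<bar> \<le> 1 + x\<^sup>2" "0 \<le> x\<^sup>2" by (simp_all add: power2_diff)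
      then have "1 + \<bar>x\<bar> \<le> 2 + 2 * x\<^sup>2" by linarith
      then show ?thesis by (simp add: power2_eq_square)
    qed
    then have "(1 + \<bar>x\<bar>) ^ m \<le> (2 + x * (x * 2)) ^ m" by (intro power_mono) auto
    then have "C * (1 + \<bar>x\<bar>) ^ m \<le> \<bar>C\<bar> * (2 + x * (x * 2)) ^ m"
      by (intro mult_mono) auto
    with bound[of x] have "\<bar>h x\<bar> \<le> \<bar>C\<bar> * (2 + x * (x * 2)) ^ m" by linarith
    then show "norm (h x) \<le> norm (poly (smult \<bar>C\<bar> ([:2, 0, 2:] ^ m)) x)"
      by (simp add: poly_power abs_mult power_abs)
  qed
qed

lemma integrable_affine_mult_cubic_growth:
  fixes \<mu> :: "real measure"
  assumes mom: "\<And>n. integrable \<mu> (\<lambda>x. x ^ n)" and h: "h \<in> borel_measurable \<mu>" and "cubic_growth h"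
  shows "integrable \<mu> (\<lambda>x. (s * x + v) * h x)"
proof -
  obtain C where C: "C > 0" "\<And>x. \<bar>h x\<bar> \<le> C * (1 + \<bar>x\<bar>) ^ 3"
    using cubic_growth_pos[OF assms(3)] by blast
  have [measurable]: "(\<lambda>x. x) \<in> borel_measurable \<mu>" using mom[of 1] by auto
  show ?thesis
  proof (rule integrable_polynomial_growth[OF mom])
    show "(\<lambda>x. (s * x + v) * h x) \<in> borel_measurable \<mu>" using h by measurable
    fix x
    have "\<bar>s * x + v\<bar> \<le> (\<bar>s\<bar> + \<bar>v\<bar>) * (1 + \<bar>x\<bar>)"
    proof -
      have "\<bar>s * x + v\<bar> \<le> \<bar>s\<bar> * \<bar>x\<bar> + \<bar>v\<bar>" by (metis abs_mult abs_triangle_ineq)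
      moreover have "0 \<le> \<bar>v\<bar> * \<bar>x\<bar>" "0 \<le> \<bar>s\<bar>" by simp_all
      ultimately show ?thesis unfolding ring_distribs by linarith
    qed
    then have "\<bar>s * x + v\<bar> * \<bar>h x\<bar> \<le> ((\<bar>s\<bar> + \<bar>v\<bar>) * (1 + \<bar>x\<bar>)) * (C * (1 + \<bar>x\<bar>) ^ 3)"
      using C(2)[of x] by (intro mult_mono) auto
    then show "\<bar>(s * x + v) * h x\<bar> \<le> ((\<bar>s\<bar> + \<bar>v\<bar>) * C) * (1 + \<bar>x\<bar>) ^ 4"
      by (simp add: abs_mult power_numeral_reduce mult_ac)
  qed
qed

text \<open>
  If the density \<open>\<rho>\<close> solves the Pearson equation \<open>((s x + v) \<rho>)' = (c - x) \<rho>\<close>, then the derivative of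
  \<open>(s x + v) \<rho> g\<close> is the difference of the two integrands times \<open>\<rho>\<close>, and the boundary terms vanish.
  The centre \<open>c\<close> makes the statement applicable to the gamma density before it is centered.
\<close>
lemma stein_identity_density:
  fixes \<rho> :: "real \<Rightarrow> real" and a b :: ereal
  defines "\<mu> \<equiv> density lborel (\<lambda>x. ennreal (\<rho> x))"
  assumes ab: "a < b" and [measurable]: "\<rho> \<in> borel_measurable borel"
    and \<rho>: "\<And>x. \<rho> x \<ge> 0" "\<And>x. x \<notin> einterval a b \<Longrightarrow> \<rho> x = 0"
    and cont: "\<And>x. x \<in> einterval a b \<Longrightarrow> isCont \<rho> x"
    and deriv: "\<And>x. x \<in> einterval a b \<Longrightarrow>
      ((\<lambda>x. (s * x + v) * \<rho> x) has_real_derivative (c - x) * \<rho> x) (at x)"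
    and lim: "(((\<lambda>x. (1 + \<bar>x\<bar>) ^ 3 * ((s * x + v) * \<rho> x)) \<circ> real_of_ereal) \<longlongrightarrow> 0) (at_right a)"
      "(((\<lambda>x. (1 + \<bar>x\<bar>) ^ 3 * ((s * x + v) * \<rho> x)) \<circ> real_of_ereal) \<longlongrightarrow> 0) (at_left b)"
    and mom: "\<And>n. integrable \<mu> (\<lambda>x. x ^ n)"
    and g: "\<And>x. (g has_real_derivative g' x) (at x)" "continuous_on UNIV g'"
      "cubic_growth g" "cubic_growth g'"
  shows "(\<integral>x. (x - c) * g x \<partial>\<mu>) = (\<integral>x. (s * x + v) * g' x \<partial>\<mu>)"
proof -
  have contg: "continuous_on UNIV g"
    using g(1) by (blast intro: continuous_at_imp_continuous_on DERIV_isCont)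
  have [measurable]: "g \<in> borel_measurable borel" "g' \<in> borel_measurable borel"
    using contg g(2) by (auto intro: borel_measurable_continuous_onI)
  obtain C where C: "C > 0" "\<And>x. \<bar>g x\<bar> \<le> C * (1 + \<bar>x\<bar>) ^ 3"
    using cubic_growth_pos[OF g(3)] by blast
  define F where "F x = ((s * x + v) * \<rho> x) * g x" for x
  define f where "f x = ((c - x) * \<rho> x) * g x + ((s * x + v) * \<rho> x) * g' x" for x
  have int1: "integrable \<mu> (\<lambda>x. (1 * x + - c) * g x)"
    by (rule integrable_affine_mult_cubic_growth[OF mom _ g(3)]) (simp add: \<mu>_def)
  have int2: "integrable \<mu> (\<lambda>x. (s * x + v) * g' x)"
    by (rule integrable_affine_mult_cubic_growth[OF mom _ g(4)]) (simp add: \<mu>_def)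
  have f_eq: "f x = \<rho> x *\<^sub>R ((s * x + v) * g' x - (1 * x + - c) * g x)" for x
    by (simp add: f_def algebra_simps)
  have "integrable \<mu> (\<lambda>x. (s * x + v) * g' x - (1 * x + - c) * g x)"
    using int1 int2 by (intro Bochner_Integration.integrable_diff)
  then have intf: "integrable lborel f"
    unfolding \<mu>_def f_eq[abs_def] by (subst (asm) integrable_density) (use \<rho> in auto)
  have F_lim: "((F \<circ> real_of_ereal) \<longlongrightarrow> 0) G"
    if "(((\<lambda>x. (1 + \<bar>x\<bar>) ^ 3 * ((s * x + v) * \<rho> x)) \<circ> real_of_ereal) \<longlongrightarrow> 0) G" for G
  proof (rule Lim_null_comparison)
    show "((\<lambda>x. C * \<bar>((\<lambda>x. (1 + \<bar>x\<bar>) ^ 3 * ((s * x + v) * \<rho> x)) \<circ> real_of_ereal) x\<bar>) \<longlongrightarrow> 0) G"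
      using tendsto_mult_left[OF tendsto_rabs[OF that], of C] by simp
    have "norm (F y) \<le> C * \<bar>(1 + \<bar>y\<bar>) ^ 3 * ((s * y + v) * \<rho> y)\<bar>" for y
    proof -
      have "\<bar>(s * y + v) * \<rho> y\<bar> * \<bar>g y\<bar> \<le> \<bar>(s * y + v) * \<rho> y\<bar> * (C * (1 + \<bar>y\<bar>) ^ 3)"
        using C(2) by (intro mult_left_mono) auto
      then show ?thesis by (simp add: F_def abs_mult mult_ac)
    qed
    then show "\<forall>\<^sub>F x in G. norm ((F \<circ> real_of_ereal) x)
        \<le> C * \<bar>((\<lambda>x. (1 + \<bar>x\<bar>) ^ 3 * ((s * x + v) * \<rho> x)) \<circ> real_of_ereal) x\<bar>"
      unfolding comp_def by (intro always_eventually allI)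
  qed
  have "(LBINT x=a..b. f x) = 0 - 0"
  proof (rule interval_integral_FTC_integrable[OF ab])
    fix x assume "a < ereal x" "ereal x < b"
    then have x: "x \<in> einterval a b" by (simp add: einterval_def)
    show "(F has_vector_derivative f x) (at x)"
      unfolding F_def f_def has_real_derivative_iff_has_vector_derivative[symmetric]
      using DERIV_mult[OF deriv[OF x] g(1)[of x]] by (simp add: mult_ac add_ac)
    show "isCont f x"
      unfolding f_def using cont[OF x] contg g(2)
      by (intro continuous_intros) (auto simp: continuous_on_eq_continuous_at)
  next
    show "set_integrable lborel (einterval a b) f"
      unfolding set_integrable_def using intf by (intro integrable_mult_indicator) auto
  qed (use F_lim lim in auto)
  also have "(LBINT x=a..b. f x) = (\<integral>x. f x \<partial>lborel)"
    using ab \<rho>(2) unfolding interval_lebesgue_integral_def set_lebesgue_integral_def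
    by (auto intro!: Bochner_Integration.integral_cong simp: f_def indicator_def)
  also have "\<dots> = (\<integral>x. (s * x + v) * g' x - (1 * x + - c) * g x \<partial>\<mu>)"
    unfolding \<mu>_def f_eq[abs_def] by (subst integral_density) (use \<rho> in auto)
  also have "\<dots> = (\<integral>x. (s * x + v) * g' x \<partial>\<mu>) - (\<integral>x. (x - c) * g x \<partial>\<mu>)"
    using int1 int2 by (subst Bochner_Integration.integral_diff) auto
  finally show ?thesis by simp
qed

lemma stein_law_std_normal: "stein_law std_normal_distribution 0 1"
  unfolding stein_law_def
proof (intro conjI allI impI)
  show mom: "integrable std_normal_distribution (\<lambda>x. x ^ n)" for n
    by (rule std_normal_moments(1))
  fix g g' :: "real \<Rightarrow> real"
  assume g: "\<forall>x. (g has_real_derivative g' x) (at x)" "continuous_on UNIV g'"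
    "cubic_growth g" "cubic_growth g'"
  have "(\<integral>x. (x - 0) * g x \<partial>std_normal_distribution)
      = (\<integral>x. (0 * x + 1) * g' x \<partial>std_normal_distribution)"
  proof (rule stein_identity_density[where a = "-\<infinity>" and b = "\<infinity>"])
    show "isCont std_normal_density x" for x
      unfolding std_normal_density_def by (intro continuous_intros) auto
    show "((\<lambda>x. (0 * x + 1) * std_normal_density x) has_real_derivative (0 - x) * std_normal_density x) (at x)" for x
      unfolding std_normal_density_def by (auto intro!: derivative_eq_intros simp: field_simps)
    have lim: "((\<lambda>x::real. (1 + \<bar>x\<bar>) ^ 3 * exp (- x\<^sup>2 / 2)) \<longlongrightarrow> 0) at_top"
      "((\<lambda>x::real. (1 + \<bar>x\<bar>) ^ 3 * exp (- x\<^sup>2 / 2)) \<longlongrightarrow> 0) at_bot"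
      by real_asymp+
    note lim' = lim[THEN tendsto_mult_right, of "1 / sqrt (2 * pi)"]
    show "(((\<lambda>x. (1 + \<bar>x\<bar>) ^ 3 * ((0 * x + 1) * std_normal_density x)) \<circ> real_of_ereal) \<longlongrightarrow> 0) (at_right (-\<infinity>))"
      "(((\<lambda>x. (1 + \<bar>x\<bar>) ^ 3 * ((0 * x + 1) * std_normal_density x)) \<circ> real_of_ereal) \<longlongrightarrow> 0) (at_left \<infinity>)"
      unfolding ereal_tendsto_simps1 std_normal_density_def using lim' by (simp_all add: mult_ac)
  qed (use g mom in auto)
  then show "(\<integral>x. x * g x \<partial>std_normal_distribution) = (\<integral>x. (0 * x + 1) * g' x \<partial>std_normal_distribution)"
    by simp
qed

lemma stein_law_centered_gamma:
  assumes "0 < \<nu>"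
  shows "stein_law (centered_gamma_distribution \<nu>) 1 \<nu>"
proof -
  define G where "G = density lborel (\<lambda>x. ennreal (gamma_density \<nu> x))"
  have \<mu>: "centered_gamma_distribution \<nu> = distr G borel (\<lambda>x. x - \<nu>)"
    by (simp add: centered_gamma_distribution_def G_def)
  have [measurable]: "gamma_density \<nu> \<in> borel_measurable borel"
    unfolding gamma_density_def[abs_def] by measurable
  have Gpos: "Gamma \<nu> > 0" using assms by (rule Gamma_real_pos)
  have [measurable_cong]: "sets G = sets borel" by (simp add: G_def)
  have momG: "integrable G (\<lambda>x. x ^ n)" for n
    using gamma_moment[OF assms] by (auto simp: has_bochner_integral_iff G_def)
  show ?thesis
    unfolding stein_law_def
  proof (intro conjI allI impI)
    show mom: "integrable (centered_gamma_distribution \<nu>) (\<lambda>x. x ^ n)" for n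
      unfolding \<mu>
    proof (subst integrable_distr_eq)
      have "(\<lambda>x. (x - \<nu>) ^ n) = poly ([:- \<nu>, 1:] ^ n)" by (auto simp: poly_power)
      then show "integrable G (\<lambda>x. (x - \<nu>) ^ n)" using poly_moments(1)[OF momG] by metis
    qed auto
    fix g g' :: "real \<Rightarrow> real"
    assume g: "\<forall>x. (g has_real_derivative g' x) (at x)" "continuous_on UNIV g'"
      "cubic_growth g" "cubic_growth g'"
    have contg: "continuous_on UNIV g"
      using g(1) by (blast intro: continuous_at_imp_continuous_on DERIV_isCont)
    have [measurable]: "g \<in> borel_measurable borel" "g' \<in> borel_measurable borel"
      using contg g(2) by (auto intro: borel_measurable_continuous_onI)
    have lim0: "((\<lambda>x. (1 + \<bar>x\<bar>) ^ 3 * (x powr \<nu> * exp (- x))) \<longlongrightarrow> 0) (at_right 0)"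
      using assms by real_asymp
    have limI: "((\<lambda>x. (1 + \<bar>x\<bar>) ^ 3 * (x powr \<nu> * exp (- x))) \<longlongrightarrow> 0) at_top"
      by real_asymp
    have xpowr: "x * gamma_density \<nu> x = (x powr \<nu> * exp (- x)) / Gamma \<nu>" if "x > 0" for x
    proof -
      have "x * x powr (\<nu> - 1) = x powr \<nu>" using that by (simp add: powr_diff)
      then show ?thesis using that by (simp add: gamma_density_def mult.assoc[symmetric])
    qed
    have "(\<integral>x. (x - \<nu>) * g (1 * x + (- \<nu>)) \<partial>G) = (\<integral>x. (1 * x + 0) * (g' (1 * x + (- \<nu>))) \<partial>G)"
      unfolding G_def
    proof (rule stein_identity_density[where a = 0 and b = "\<infinity>"])
      show "gamma_density \<nu> x = 0" if "x \<notin> einterval 0 \<infinity>" for x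
        using that by (auto simp: gamma_density_def einterval_def zero_ereal_def)
      show "gamma_density \<nu> x \<ge> 0" for x using Gpos by (simp add: gamma_density_def)
      fix x assume "x \<in> einterval 0 \<infinity>"
      then have x: "x > 0" by (auto simp: einterval_def zero_ereal_def)
      have ev: "\<forall>\<^sub>F y in nhds x. gamma_density \<nu> y = y powr (\<nu> - 1) * exp (- y) / Gamma \<nu>"
        using eventually_nhds_in_open[of "{0<..}" x] x
        by (auto simp: gamma_density_def elim!: eventually_mono)
      show "isCont (gamma_density \<nu>) x"
        unfolding isCont_cong[OF ev] using x Gpos by (intro continuous_intros) auto
      have ev2: "\<forall>\<^sub>F y in nhds x. (1 * y + 0) * gamma_density \<nu> y = (y powr \<nu> * exp (- y)) / Gamma \<nu>"
        using eventually_nhds_in_open[of "{0<..}" x] x xpowr by (auto elim!: eventually_mono)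
      have "((\<lambda>y. (y powr \<nu> * exp (- y)) / Gamma \<nu>) has_real_derivative
          (\<nu> * x powr (\<nu> - 1) * exp (- x) - x powr \<nu> * exp (- x)) / Gamma \<nu>) (at x)"
        using x Gpos by (auto intro!: derivative_eq_intros simp: field_simps)
      also have "(\<nu> * x powr (\<nu> - 1) * exp (- x) - x powr \<nu> * exp (- x)) / Gamma \<nu>
          = (\<nu> - x) * gamma_density \<nu> x"
        using x xpowr[OF x] by (simp add: gamma_density_def field_simps)
      finally show "((\<lambda>x. (1 * x + 0) * gamma_density \<nu> x) has_real_derivative
          (\<nu> - x) * gamma_density \<nu> x) (at x)"
        by (subst DERIV_cong_ev[OF refl ev2 refl])
    next
      have "((\<lambda>x. (1 + \<bar>x\<bar>) ^ 3 * ((1 * x + 0) * gamma_density \<nu> x)) \<longlongrightarrow> 0) F"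
        if "((\<lambda>x. (1 + \<bar>x\<bar>) ^ 3 * (x powr \<nu> * exp (- x))) \<longlongrightarrow> 0) F" "\<forall>\<^sub>F x in F. x > 0" for F
      proof (rule Lim_transform_eventually)
        show "((\<lambda>x. (1 + \<bar>x\<bar>) ^ 3 * (x powr \<nu> * exp (- x)) * (1 / Gamma \<nu>)) \<longlongrightarrow> 0) F"
          using tendsto_mult_right[OF that(1), of "1 / Gamma \<nu>"] by simp
        show "\<forall>\<^sub>F x in F. (1 + \<bar>x\<bar>) ^ 3 * (x powr \<nu> * exp (- x)) * (1 / Gamma \<nu>)
            = (1 + \<bar>x\<bar>) ^ 3 * ((1 * x + 0) * gamma_density \<nu> x)"
          using that(2) by eventually_elim (simp add: xpowr)
      qed
      from this[OF lim0] this[OF limI]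
      show "(((\<lambda>x. (1 + \<bar>x\<bar>) ^ 3 * ((1 * x + 0) * gamma_density \<nu> x)) \<circ> real_of_ereal) \<longlongrightarrow> 0) (at_right 0)"
        "(((\<lambda>x. (1 + \<bar>x\<bar>) ^ 3 * ((1 * x + 0) * gamma_density \<nu> x)) \<circ> real_of_ereal) \<longlongrightarrow> 0) (at_left \<infinity>)"
        unfolding zero_ereal_def ereal_tendsto_simps1
        by (simp_all add: eventually_at_right_less eventually_gt_at_top)
    next
      show "((\<lambda>x. g (1 * x + - \<nu>)) has_real_derivative g' (1 * x + - \<nu>)) (at x)" for x
        using g(1) DERIV_shift[of g "g' (x - \<nu>)" x "- \<nu>"] by simp
      show "continuous_on UNIV (\<lambda>x. g' (1 * x + - \<nu>))"
        by (rule continuous_on_compose2[OF g(2)]) (auto intro!: continuous_intros)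
      show "cubic_growth (\<lambda>x. g (1 * x + - \<nu>))" "cubic_growth (\<lambda>x. g' (1 * x + - \<nu>))"
        using cubic_growth_affine[OF g(3), of 1 1 "-\<nu>"] cubic_growth_affine[OF g(4), of 1 1 "-\<nu>"]
        by simp_all
    qed (use momG in \<open>auto simp: G_def\<close>)
    then show "(\<integral>x. x * g x \<partial>centered_gamma_distribution \<nu>)
        = (\<integral>x. (1 * x + \<nu>) * g' x \<partial>centered_gamma_distribution \<nu>)"
      unfolding \<mu> by (simp add: integral_distr)
  qed
qed

lemma gaussian_gamma_law_stein:
  assumes "\<mu> \<in> gaussian_gamma_laws"
  obtains s v where "stein_law \<mu> s v"
  using assms stein_law_std_normal stein_law_centered_gamma
  unfolding gaussian_gamma_laws_def by blast

section \<open>Random variables with all moments\<close>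

definition all_moments :: "'a measure \<Rightarrow> ('a \<Rightarrow> real) \<Rightarrow> bool" where
  "all_moments M Y \<longleftrightarrow> Y \<in> borel_measurable M \<and> (\<forall>p::nat. integrable M (\<lambda>\<omega>. \<bar>Y \<omega>\<bar> ^ p))"

lemma all_moments_measurable: "all_moments M Y \<Longrightarrow> Y \<in> borel_measurable M"
  by (simp add: all_moments_def)

lemma all_moments_integrable:
  assumes "all_moments M Y" shows "integrable M Y"
proof -
  have "integrable M (\<lambda>\<omega>. \<bar>Y \<omega>\<bar> ^ 1)" using assms unfolding all_moments_def by blast
  then show ?thesis using all_moments_measurable[OF assms] by (simp add: integrable_abs_iff)
qed

lemma all_moments_bound:
  assumes "all_moments M Z" and [measurable]: "Y \<in> borel_measurable M"
    and le: "\<And>\<omega>. \<bar>Y \<omega>\<bar> \<le> \<bar>Z \<omega>\<bar>"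
  shows "all_moments M Y"
  unfolding all_moments_def
proof (intro conjI allI)
  fix p :: nat
  show "integrable M (\<lambda>\<omega>. \<bar>Y \<omega>\<bar> ^ p)"
  proof (rule Bochner_Integration.integrable_bound)
    show "integrable M (\<lambda>\<omega>. \<bar>Z \<omega>\<bar> ^ p)" using assms(1) by (simp add: all_moments_def)
    show "AE \<omega> in M. norm (\<bar>Y \<omega>\<bar> ^ p) \<le> norm (\<bar>Z \<omega>\<bar> ^ p)"
      using le by (auto intro!: power_mono simp: power_abs)
  qed simp
qed fact

lemma all_moments_const: "prob_space M \<Longrightarrow> all_moments M (\<lambda>_. c)"
  by (simp add: all_moments_def prob_space.finite_measure finite_measure.integrable_const)

text \<open>
  With the rules for sums below, variables with all moments form an algebra, so that polynomial
  expressions in such variables are integrable. The bound is \<open>2 y z \<le> y\<^sup>2 + z\<^sup>2\<close>.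
\<close>
lemma all_moments_mult:
  assumes "all_moments M Y" "all_moments M Z"
  shows "all_moments M (\<lambda>\<omega>. Y \<omega> * Z \<omega>)"
  unfolding all_moments_def
proof (intro conjI allI)
  note [measurable] = assms[THEN all_moments_measurable]
  show "(\<lambda>\<omega>. Y \<omega> * Z \<omega>) \<in> borel_measurable M" by measurable
  fix p :: nat
  show "integrable M (\<lambda>\<omega>. \<bar>Y \<omega> * Z \<omega>\<bar> ^ p)"
  proof (rule Bochner_Integration.integrable_bound)
    show "integrable M (\<lambda>\<omega>. \<bar>Y \<omega>\<bar> ^ (2 * p) + \<bar>Z \<omega>\<bar> ^ (2 * p))"
      using assms unfolding all_moments_def by (intro Bochner_Integration.integrable_add) blast+
    show "AE \<omega> in M. norm (\<bar>Y \<omega> * Z \<omega>\<bar> ^ p) \<le> norm (\<bar>Y \<omega>\<bar> ^ (2 * p) + \<bar>Z \<omega>\<bar> ^ (2 * p))"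
    proof (rule AE_I2)
      fix \<omega>
      define y z where "y = \<bar>Y \<omega>\<bar> ^ p" and "z = \<bar>Z \<omega>\<bar> ^ p"
      have "2 * (y * z) \<le> y\<^sup>2 + z\<^sup>2" using sum_squares_bound[of y z] by (simp add: mult_ac)
      moreover have "0 \<le> y * z" by (simp add: y_def z_def)
      ultimately have "y * z \<le> y\<^sup>2 + z\<^sup>2" by linarith
      then show "norm (\<bar>Y \<omega> * Z \<omega>\<bar> ^ p) \<le> norm (\<bar>Y \<omega>\<bar> ^ (2 * p) + \<bar>Z \<omega>\<bar> ^ (2 * p))"
        by (simp add: y_def z_def abs_mult power_mult_distrib power_mult[symmetric] mult.commute[of p])
    qed
  qed measurable
qed

lemma all_moments_add:
  assumes "all_moments M Y" "all_moments M Z"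
  shows "all_moments M (\<lambda>\<omega>. Y \<omega> + Z \<omega>)"
  unfolding all_moments_def
proof (intro conjI allI)
  note [measurable] = assms[THEN all_moments_measurable]
  show "(\<lambda>\<omega>. Y \<omega> + Z \<omega>) \<in> borel_measurable M" by measurable
  fix p :: nat
  show "integrable M (\<lambda>\<omega>. \<bar>Y \<omega> + Z \<omega>\<bar> ^ p)"
  proof (rule Bochner_Integration.integrable_bound)
    show "integrable M (\<lambda>\<omega>. 2 ^ p * (\<bar>Y \<omega>\<bar> ^ p + \<bar>Z \<omega>\<bar> ^ p))"
      using assms unfolding all_moments_def
      by (intro integrable_mult_right Bochner_Integration.integrable_add) blast+
    show "AE \<omega> in M. norm (\<bar>Y \<omega> + Z \<omega>\<bar> ^ p) \<le> norm (2 ^ p * (\<bar>Y \<omega>\<bar> ^ p + \<bar>Z \<omega>\<bar> ^ p))"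
    proof (rule AE_I2)
      fix \<omega>
      let ?m = "max \<bar>Y \<omega>\<bar> \<bar>Z \<omega>\<bar>"
      have "\<bar>Y \<omega> + Z \<omega>\<bar> ^ p \<le> (2 * ?m) ^ p" by (intro power_mono) auto
      also have "\<dots> = 2 ^ p * ?m ^ p" by (simp add: power_mult_distrib)
      also have "\<dots> \<le> 2 ^ p * (\<bar>Y \<omega>\<bar> ^ p + \<bar>Z \<omega>\<bar> ^ p)"
        by (intro mult_left_mono) (auto simp: max_def)
      finally show "norm (\<bar>Y \<omega> + Z \<omega>\<bar> ^ p) \<le> norm (2 ^ p * (\<bar>Y \<omega>\<bar> ^ p + \<bar>Z \<omega>\<bar> ^ p))" by simp
    qed
  qed measurable
qed

lemma all_moments_diff:
  assumes "prob_space M" "all_moments M Y" "all_moments M Z"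
  shows "all_moments M (\<lambda>\<omega>. Y \<omega> - Z \<omega>)"
  using all_moments_add[OF assms(2) all_moments_mult[OF all_moments_const[OF assms(1)] assms(3)], of "- 1"]
  by simp

lemma all_moments_sum:
  assumes "prob_space M" "\<And>i. i \<in> A \<Longrightarrow> all_moments M (Y i)"
  shows "all_moments M (\<lambda>\<omega>. \<Sum>i\<in>A. Y i \<omega>)"
  using assms(2)
  by (induction A rule: infinite_finite_induct)
     (auto intro: all_moments_add all_moments_const[OF assms(1)])

lemma all_moments_prod:
  assumes "prob_space M" "\<And>i. i \<in> A \<Longrightarrow> all_moments M (Y i)"
  shows "all_moments M (\<lambda>\<omega>. \<Prod>i\<in>A. Y i \<omega>)"
  using assms(2)
  by (induction A rule: infinite_finite_induct)
     (auto intro: all_moments_mult all_moments_const[OF assms(1)])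

lemma all_moments_power:
  assumes "prob_space M" "all_moments M Y"
  shows "all_moments M (\<lambda>\<omega>. Y \<omega> ^ k)"
  by (induction k) (auto intro: all_moments_mult all_moments_const assms)

lemma all_moments_abs: "all_moments M Y \<Longrightarrow> all_moments M (\<lambda>\<omega>. \<bar>Y \<omega>\<bar>)"
  by (auto simp: all_moments_def)

lemmas all_moments_intros =
  all_moments_const all_moments_mult all_moments_add all_moments_diff all_moments_sum
  all_moments_prod all_moments_power

lemma all_moments_cubic_growth:
  assumes "prob_space M" "all_moments M Y" "cubic_growth \<phi>" "\<phi> \<in> borel_measurable borel"
  shows "all_moments M (\<lambda>\<omega>. \<phi> (Y \<omega>))"
proof -
  note [measurable] = all_moments_measurable[OF assms(2)] assms(4)
  obtain C where C: "C > 0" "\<And>x. \<bar>\<phi> x\<bar> \<le> C * (1 + \<bar>x\<bar>) ^ 3"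
    using cubic_growth_pos[OF assms(3)] by blast
  show ?thesis
  proof (rule all_moments_bound)
    show "all_moments M (\<lambda>\<omega>. C * (1 + \<bar>Y \<omega>\<bar>) ^ 3)"
      by (intro all_moments_intros all_moments_abs assms)
    show "\<bar>\<phi> (Y \<omega>)\<bar> \<le> \<bar>C * (1 + \<bar>Y \<omega>\<bar>) ^ 3\<bar>" for \<omega>
      using C(2)[of "Y \<omega>"] by linarith
  qed measurable
qed

lemma all_moments_stein_law:
  assumes "stein_law (distr M borel Y) s v" and [measurable]: "Y \<in> borel_measurable M"
  shows "all_moments M Y"
proof -
  have "integrable M (\<lambda>\<omega>. Y \<omega> ^ p)" for p
    using assms(1) unfolding stein_law_def by (subst (asm) integrable_distr_eq) auto
  then have "integrable M (\<lambda>\<omega>. \<bar>Y \<omega> ^ p\<bar>)" for p by (intro integrable_abs)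
  then show ?thesis by (simp add: all_moments_def power_abs)
qed

text \<open>
  The test functions \<open>1\<close>, \<open>x\<close> and \<open>x\<^sup>2\<close> in the Stein identity determine the first three moments.
\<close>
lemma stein_law_moments:
  assumes "stein_law \<mu> s v" "prob_space \<mu>"
  shows "(\<integral>x. x \<partial>\<mu>) = 0" "(\<integral>x. x ^ 2 \<partial>\<mu>) = v" "(\<integral>x. x ^ 3 \<partial>\<mu>) = 2 * s * v"
proof -
  interpret prob_space \<mu> by fact
  have int: "integrable \<mu> (\<lambda>x. x ^ n)" for n
    using assms(1) by (simp add: stein_law_def)
  have id: "(\<integral>x. x * g x \<partial>\<mu>) = (\<integral>x. (s * x + v) * g' x \<partial>\<mu>)"
    if "\<And>x. (g has_real_derivative g' x) (at x)" "continuous_on UNIV g'"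
      "cubic_growth g" "cubic_growth g'" for g g'
    using assms(1) that unfolding stein_law_def by blast
  have growth: "cubic_growth (\<lambda>_. 0)" "cubic_growth (\<lambda>_. 1)" "cubic_growth (\<lambda>x. x)"
    "cubic_growth (\<lambda>x. x\<^sup>2)" "cubic_growth (\<lambda>x. 2 * x)"
    using cubic_growth_monomial[of 0 0] cubic_growth_monomial[of 0 1] cubic_growth_monomial[of 1 1]
      cubic_growth_monomial[of 2 1] cubic_growth_monomial[of 1 2] by simp_all
  have int1: "integrable \<mu> (\<lambda>x. x)" using int[of 1] by simp
  have "(\<integral>x. x * 1 \<partial>\<mu>) = (\<integral>x. (s * x + v) * 0 \<partial>\<mu>)"
    by (rule id) (auto intro: growth)
  then show m1: "(\<integral>x. x \<partial>\<mu>) = 0" by simp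
  have "(\<integral>x. x * x \<partial>\<mu>) = (\<integral>x. (s * x + v) * 1 \<partial>\<mu>)"
    by (rule id) (auto intro: growth)
  also have "\<dots> = v" using int1 m1 prob_space by simp
  finally show m2: "(\<integral>x. x ^ 2 \<partial>\<mu>) = v" by (simp add: power2_eq_square)
  have "(\<integral>x. x * x\<^sup>2 \<partial>\<mu>) = (\<integral>x. (s * x + v) * (2 * x) \<partial>\<mu>)"
    by (rule id) (auto intro!: derivative_eq_intros continuous_intros growth)
  also have "\<dots> = (\<integral>x. 2 * s * x\<^sup>2 + 2 * v * x \<partial>\<mu>)"
    by (simp add: algebra_simps power2_eq_square)
  also have "\<dots> = 2 * s * v"
    using int1 int[of 2] m1 m2 by simp
  finally show "(\<integral>x. x ^ 3 \<partial>\<mu>) = 2 * s * v"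
    by (simp add: power2_eq_square power3_eq_cube mult_ac)
qed

section \<open>Integration by parts for multilinear forms\<close>

text \<open>
  Once \<open>Y\<close> is frozen, this is the Stein identity of \<open>z (U)\<close> for the test function
  \<open>x \<mapsto> \<alpha> \<phi> (\<alpha> x + \<beta>)\<close>. The maps \<open>z\<close>, \<open>\<alpha>\<close>, \<open>\<beta>\<close> are kept separate because the two arguments of
  \<^const>\<open>prob_space.indep_var\<close> have values in the same type.
\<close>
lemma (in prob_space) conditional_stein_identity:
  assumes indep: "indep_var N\<^sub>1 U N\<^sub>2 Y"
    and [measurable]: "z \<in> borel_measurable N\<^sub>1" "\<alpha> \<in> borel_measurable N\<^sub>2" "\<beta> \<in> borel_measurable N\<^sub>2"
    and stein: "stein_law (distr M borel (\<lambda>\<omega>. z (U \<omega>))) s v"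
    and \<phi>: "\<And>x. (\<phi> has_real_derivative \<phi>' x) (at x)" "continuous_on UNIV \<phi>'"
      "cubic_growth \<phi>" "cubic_growth \<phi>'"
    and int: "integrable M (\<lambda>\<omega>. z (U \<omega>) * \<alpha> (Y \<omega>) * \<phi> (\<alpha> (Y \<omega>) * z (U \<omega>) + \<beta> (Y \<omega>)))"
      "integrable M (\<lambda>\<omega>. (s * z (U \<omega>) + v) * (\<alpha> (Y \<omega>))\<^sup>2 * \<phi>' (\<alpha> (Y \<omega>) * z (U \<omega>) + \<beta> (Y \<omega>)))"
  shows "expectation (\<lambda>\<omega>. z (U \<omega>) * \<alpha> (Y \<omega>) * \<phi> (\<alpha> (Y \<omega>) * z (U \<omega>) + \<beta> (Y \<omega>)))
       = expectation (\<lambda>\<omega>. (s * z (U \<omega>) + v) * (\<alpha> (Y \<omega>))\<^sup>2 * \<phi>' (\<alpha> (Y \<omega>) * z (U \<omega>) + \<beta> (Y \<omega>)))"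
proof -
  let ?\<mu> = "distr M N\<^sub>1 U" and ?\<eta> = "distr M N\<^sub>2 Y"
  have [measurable]: "U \<in> M \<rightarrow>\<^sub>M N\<^sub>1" "Y \<in> M \<rightarrow>\<^sub>M N\<^sub>2"
    and joint: "?\<mu> \<Otimes>\<^sub>M ?\<eta> = distr M (N\<^sub>1 \<Otimes>\<^sub>M N\<^sub>2) (\<lambda>\<omega>. (U \<omega>, Y \<omega>))"
    using indep unfolding indep_var_distribution_eq by auto
  interpret \<mu>: prob_space ?\<mu> by (rule prob_space_distr) simp
  interpret \<eta>: prob_space ?\<eta> by (rule prob_space_distr) simp
  interpret pair_sigma_finite ?\<mu> ?\<eta> ..
  have "continuous_on UNIV \<phi>"
    using \<phi>(1) by (blast intro: continuous_at_imp_continuous_on DERIV_isCont)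
  then have [measurable]: "\<phi> \<in> borel_measurable borel" "\<phi>' \<in> borel_measurable borel"
    using \<phi>(2) by (auto intro: borel_measurable_continuous_onI)
  define f where "f u y = z u * \<alpha> y * \<phi> (\<alpha> y * z u + \<beta> y)" for u y
  define h where "h u y = (s * z u + v) * (\<alpha> y)\<^sup>2 * \<phi>' (\<alpha> y * z u + \<beta> y)" for u y
  have [measurable]: "case_prod f \<in> borel_measurable (N\<^sub>1 \<Otimes>\<^sub>M N\<^sub>2)" "case_prod h \<in> borel_measurable (N\<^sub>1 \<Otimes>\<^sub>M N\<^sub>2)"
    unfolding f_def h_def by measurable
  have intf: "integrable (?\<mu> \<Otimes>\<^sub>M ?\<eta>) (case_prod f)" and inth: "integrable (?\<mu> \<Otimes>\<^sub>M ?\<eta>) (case_prod h)"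
    unfolding joint using int by (simp_all add: integrable_distr_eq f_def h_def)
  have inner: "(\<integral>u. f u y \<partial>?\<mu>) = (\<integral>u. h u y \<partial>?\<mu>)" for y
  proof -
    let ?\<kappa> = "distr M borel (\<lambda>\<omega>. z (U \<omega>))"
    have "(\<integral>x. x * (\<alpha> y * \<phi> (\<alpha> y * x + \<beta> y)) \<partial>?\<kappa>) = (\<integral>x. (s * x + v) * ((\<alpha> y)\<^sup>2 * \<phi>' (\<alpha> y * x + \<beta> y)) \<partial>?\<kappa>)"
    proof (rule stein[unfolded stein_law_def, THEN conjunct2, rule_format])
      show "((\<lambda>x. \<alpha> y * \<phi> (\<alpha> y * x + \<beta> y)) has_real_derivative (\<alpha> y)\<^sup>2 * \<phi>' (\<alpha> y * x + \<beta> y)) (at x)" for x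
        by (rule derivative_eq_intros DERIV_chain2[OF \<phi>(1)] refl)+ (simp add: power2_eq_square)
      show "continuous_on UNIV (\<lambda>x. (\<alpha> y)\<^sup>2 * \<phi>' (\<alpha> y * x + \<beta> y))"
        by (intro continuous_intros continuous_on_compose2[OF \<phi>(2)]) auto
    qed (use cubic_growth_affine \<phi> in blast)+
    then show ?thesis by (simp add: f_def h_def integral_distr mult.assoc)
  qed
  have "expectation (\<lambda>\<omega>. f (U \<omega>) (Y \<omega>)) = (\<integral>p. case_prod f p \<partial>(?\<mu> \<Otimes>\<^sub>M ?\<eta>))"
    unfolding joint by (subst integral_distr) auto
  also have "\<dots> = (\<integral>y. (\<integral>u. f u y \<partial>?\<mu>) \<partial>?\<eta>)" by (rule integral_snd[OF intf, symmetric])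
  also have "\<dots> = (\<integral>y. (\<integral>u. h u y \<partial>?\<mu>) \<partial>?\<eta>)" by (simp only: inner)
  also have "\<dots> = (\<integral>p. case_prod h p \<partial>(?\<mu> \<Otimes>\<^sub>M ?\<eta>))" by (rule integral_snd[OF inth])
  also have "\<dots> = expectation (\<lambda>\<omega>. h (U \<omega>) (Y \<omega>))"
    unfolding joint by (subst integral_distr) auto
  finally show ?thesis by (simp only: f_def h_def)
qed

text \<open>
  A homogeneous multilinear form of degree \<open>d\<close> is indexed by a family \<open>S\<close> of sets with \<open>d\<close> elements:
  a monomial without repeated factors is determined by the set of its variables.
\<close>
locale multilinear_form = prob_space M for M :: "'a measure" +
  fixes X :: "'i \<Rightarrow> 'a \<Rightarrow> real" and s v :: "'i \<Rightarrow> real"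
    and V :: "'i set" and S :: "'i set set" and c :: "'i set \<Rightarrow> real" and d :: nat
  assumes indep: "indep_vars (\<lambda>_. borel) X UNIV"
    and stein: "\<And>i. stein_law (distr M borel (X i)) (s i) (v i)"
    and finite_V: "finite V"
    and S_sub: "\<And>I. I \<in> S \<Longrightarrow> I \<subseteq> V" and S_card: "\<And>I. I \<in> S \<Longrightarrow> card I = d"
begin

definition P :: "('i \<Rightarrow> real) \<Rightarrow> real" where
  "P x = (\<Sum>I\<in>S. c I * (\<Prod>i\<in>I. x i))"

definition partial :: "'i \<Rightarrow> ('i \<Rightarrow> real) \<Rightarrow> real" where
  "partial i x = (\<Sum>I\<in>S. if i \<in> I then c I * (\<Prod>j\<in>I - {i}. x j) else 0)"

text \<open>
  The carre du champ of \<open>P\<close> with itself for the tensorized generator.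
\<close>
definition \<Gamma> :: "('i \<Rightarrow> real) \<Rightarrow> real" where
  "\<Gamma> x = (\<Sum>i\<in>V. (s i * x i + v i) * (partial i x)\<^sup>2)"

abbreviation W :: "'a \<Rightarrow> 'i \<Rightarrow> real" where
  "W \<omega> \<equiv> \<lambda>i. X i \<omega>"

lemma finite_in_S: "I \<in> S \<Longrightarrow> finite I"
  using S_sub finite_V finite_subset by blast

lemma X_measurable [measurable]: "X i \<in> borel_measurable M"
  using indep by (auto simp: indep_vars_def)

lemma euler_identity: "(\<Sum>i\<in>V. x i * partial i x) = real d * P x"
proof -
  have "(\<Sum>i\<in>V. x i * partial i x)
      = (\<Sum>i\<in>V. \<Sum>I\<in>S. if i \<in> I then c I * (\<Prod>j\<in>I. x j) else 0)"
    unfolding partial_def sum_distrib_left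
    by (intro sum.cong refl) (auto simp: finite_in_S prod.remove)
  also have "\<dots> = (\<Sum>I\<in>S. \<Sum>i\<in>V. if i \<in> I then c I * (\<Prod>j\<in>I. x j) else 0)"
    by (rule sum.swap)
  also have "\<dots> = (\<Sum>I\<in>S. real d * (c I * (\<Prod>j\<in>I. x j)))"
  proof (intro sum.cong refl)
    fix I assume I: "I \<in> S"
    then have "V \<inter> I = I" using S_sub by blast
    then show "(\<Sum>i\<in>V. if i \<in> I then c I * (\<Prod>j\<in>I. x j) else 0) = real d * (c I * (\<Prod>j\<in>I. x j))"
      using S_card[OF I] by (simp add: sum.inter_restrict[OF finite_V, symmetric])
  qed
  finally show ?thesis by (simp add: P_def sum_distrib_left)
qed

lemma all_moments_X: "all_moments M (X i)"
  by (rule all_moments_stein_law[OF stein]) simp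

lemma all_moments_P: "all_moments M (\<lambda>\<omega>. P (W \<omega>))"
  unfolding P_def by (intro all_moments_intros all_moments_X prob_space_axioms)

lemma all_moments_partial: "all_moments M (\<lambda>\<omega>. partial i (W \<omega>))"
  unfolding partial_def
proof (intro all_moments_sum prob_space_axioms)
  fix I
  show "all_moments M (\<lambda>\<omega>. if i \<in> I then c I * (\<Prod>j\<in>I - {i}. X j \<omega>) else 0)"
    by (cases "i \<in> I") (simp_all add: all_moments_intros all_moments_X prob_space_axioms)
qed

lemma all_moments_\<Gamma>: "all_moments M (\<lambda>\<omega>. \<Gamma> (W \<omega>))"
  unfolding \<Gamma>_def by (intro all_moments_intros all_moments_X all_moments_partial prob_space_axioms)

text \<open>
  For each \<open>i\<close> the form splits as \<open>P x = partial i x * x i + R i x\<close>, where \<open>partial i\<close> and \<open>R i\<close> do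
  not depend on \<open>x i\<close>. The conditional Stein identity applies to each summand of Euler's identity.
\<close>
lemma integration_by_parts:
  assumes \<phi>: "\<And>x. (\<phi> has_real_derivative \<phi>' x) (at x)" "continuous_on UNIV \<phi>'"
      "cubic_growth \<phi>" "cubic_growth \<phi>'"
  shows "real d * expectation (\<lambda>\<omega>. P (W \<omega>) * \<phi> (P (W \<omega>)))
       = expectation (\<lambda>\<omega>. \<Gamma> (W \<omega>) * \<phi>' (P (W \<omega>)))"
proof -
  have "continuous_on UNIV \<phi>"
    using \<phi>(1) by (blast intro: continuous_at_imp_continuous_on DERIV_isCont)
  then have meas: "\<phi> \<in> borel_measurable borel" "\<phi>' \<in> borel_measurable borel"
    using \<phi>(2) by (auto intro: borel_measurable_continuous_onI)
  note am = all_moments_intros prob_space_axioms all_moments_X all_moments_P all_moments_partial all_moments_\<Gamma>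
    all_moments_cubic_growth[OF _ _ \<phi>(3) meas(1)] all_moments_cubic_growth[OF _ _ \<phi>(4) meas(2)]
  define R where "R i x = (\<Sum>I\<in>S. if i \<in> I then 0 else c I * (\<Prod>j\<in>I. x j))" for i and x :: "'i \<Rightarrow> real"
  have split: "P x = partial i x * x i + R i x" for i x
    unfolding P_def partial_def R_def sum_distrib_right sum.distrib[symmetric]
    by (intro sum.cong refl) (auto simp: finite_in_S prod.remove)
  have one: "expectation (\<lambda>\<omega>. X i \<omega> * partial i (W \<omega>) * \<phi> (P (W \<omega>)))
      = expectation (\<lambda>\<omega>. (s i * X i \<omega> + v i) * (partial i (W \<omega>))\<^sup>2 * \<phi>' (P (W \<omega>)))" for i
  proof -
    let ?K = "UNIV - {i}"
    have ind: "indep_var (PiM {i} (\<lambda>_. borel)) (\<lambda>\<omega>. restrict (W \<omega>) {i})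
        (PiM ?K (\<lambda>_. borel)) (\<lambda>\<omega>. restrict (W \<omega>) ?K)"
      by (rule indep_var_restrict[OF indep]) auto
    have comp: "(\<lambda>x. if j \<noteq> i then x j else 0) \<in> borel_measurable (PiM ?K (\<lambda>_. borel))" for j
      by (cases "j = i") auto
    have 1: "partial i = (\<lambda>x. \<Sum>I\<in>S. if i \<in> I then c I * (\<Prod>j\<in>I - {i}. if j \<noteq> i then x j else 0) else 0)"
      unfolding partial_def by (intro ext sum.cong prod.cong arg_cong2[where f="(*)"] refl if_cong) auto
    have 2: "R i = (\<lambda>x. \<Sum>I\<in>S. if i \<in> I then 0 else c I * (\<Prod>j\<in>I. if j \<noteq> i then x j else 0))"
      unfolding R_def by (intro ext sum.cong refl) (auto intro!: prod.cong)
    have DR_meas: "partial i \<in> borel_measurable (PiM ?K (\<lambda>_. borel))"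
      "R i \<in> borel_measurable (PiM ?K (\<lambda>_. borel))"
      unfolding 1 2 by (intro borel_measurable_sum measurable_If borel_measurable_times
        borel_measurable_const borel_measurable_prod comp; simp)+
    have DR: "partial i (restrict x ?K) = partial i x" "R i (restrict x ?K) = R i x" for x
      unfolding partial_def R_def by (intro sum.cong refl; auto intro!: prod.cong)+
    have st: "stein_law (distr M borel (\<lambda>\<omega>. restrict (W \<omega>) {i} i)) (s i) (v i)"
      using stein by simp
    have int: "integrable M (\<lambda>\<omega>. X i \<omega> * partial i (W \<omega>) * \<phi> (partial i (W \<omega>) * X i \<omega> + R i (W \<omega>)))"
      "integrable M (\<lambda>\<omega>. (s i * X i \<omega> + v i) * (partial i (W \<omega>))\<^sup>2 * \<phi>' (partial i (W \<omega>) * X i \<omega> + R i (W \<omega>)))"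
      unfolding split[of "W _" i, symmetric] by (intro all_moments_integrable am)+
    have z: "(\<lambda>x. x i) \<in> borel_measurable (PiM {i} (\<lambda>_. borel))" by simp
    have i: "restrict (W \<omega>) {i} i = X i \<omega>" for \<omega> by simp
    show ?thesis
      unfolding split[of _ i]
      by (rule conditional_stein_identity[OF ind z DR_meas _ \<phi>, unfolded i DR, OF stein int])
  qed
  have "real d * expectation (\<lambda>\<omega>. P (W \<omega>) * \<phi> (P (W \<omega>)))
      = expectation (\<lambda>\<omega>. \<Sum>i\<in>V. X i \<omega> * partial i (W \<omega>) * \<phi> (P (W \<omega>)))"
    unfolding sum_distrib_right[symmetric] euler_identity by (simp add: mult.assoc)
  also have "\<dots> = (\<Sum>i\<in>V. expectation (\<lambda>\<omega>. X i \<omega> * partial i (W \<omega>) * \<phi> (P (W \<omega>))))"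
    by (rule Bochner_Integration.integral_sum) (intro all_moments_integrable am)
  also have "\<dots> = (\<Sum>i\<in>V. expectation (\<lambda>\<omega>. (s i * X i \<omega> + v i) * (partial i (W \<omega>))\<^sup>2 * \<phi>' (P (W \<omega>))))"
    by (simp only: one)
  also have "\<dots> = expectation (\<lambda>\<omega>. \<Sum>i\<in>V. (s i * X i \<omega> + v i) * (partial i (W \<omega>))\<^sup>2 * \<phi>' (P (W \<omega>)))"
    by (rule Bochner_Integration.integral_sum[symmetric]) (intro all_moments_integrable am)
  also have "\<dots> = expectation (\<lambda>\<omega>. \<Gamma> (W \<omega>) * \<phi>' (P (W \<omega>)))"
    by (simp only: sum_distrib_right[symmetric] \<Gamma>_def)
  finally show ?thesis .
qed

section \<open>The spectral inequality\<close>

text \<open>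
  Eigenfunctions, with eigenvalues 0, -1, -2, of the generator \<open>(s i * x + v i) f'' - x f'\<close>. The form
  is affine in each variable, so no higher degree occurs in its square.
\<close>
definition eigen_poly :: "'i \<Rightarrow> nat \<Rightarrow> real \<Rightarrow> real" where
  "eigen_poly i k x = (if k = 0 then 1 else if k = 1 then x else x\<^sup>2 - 2 * s i * x - v i)"

text \<open>
  The coefficients of \<open>x ^ e\<close>, \<open>e \<le> 2\<close>, with respect to \<^term>\<open>eigen_poly i\<close>.
\<close>
definition eigen_coeff :: "'i \<Rightarrow> nat \<Rightarrow> nat \<Rightarrow> real" where
  "eigen_coeff i e k = (if e = 2 then (if k = 0 then v i else if k = 1 then 2 * s i else 1) else of_bool (e = k))"

definition expo :: "'i set \<Rightarrow> 'i set \<Rightarrow> 'i \<Rightarrow> nat" where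
  "expo I J i = of_bool (i \<in> I) + of_bool (i \<in> J)"

definition multi_indices :: "('i \<Rightarrow> nat) set" where
  "multi_indices = PiE V (\<lambda>_. {..2})"

definition eigen_prod :: "('i \<Rightarrow> nat) \<Rightarrow> ('i \<Rightarrow> real) \<Rightarrow> real" where
  "eigen_prod \<kappa> x = (\<Prod>i\<in>V. eigen_poly i (\<kappa> i) (x i))"

definition square_coeff :: "('i \<Rightarrow> nat) \<Rightarrow> real" where
  "square_coeff \<kappa> = (\<Sum>I\<in>S. \<Sum>J\<in>S. c I * c J * (\<Prod>i\<in>V. eigen_coeff i (expo I J i) (\<kappa> i)))"

text \<open>
  The eigenvalue of \<open>(L + 2 d) / 2\<close> on the component of multi-index \<open>\<kappa>\<close>, where \<open>L\<close> is the tensorized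
  generator.
\<close>
definition weight :: "('i \<Rightarrow> nat) \<Rightarrow> real" where
  "weight \<kappa> = real d - (\<Sum>i\<in>V. real (\<kappa> i)) / 2"

lemma finite_multi_indices: "finite multi_indices"
  unfolding multi_indices_def using finite_V by (intro finite_PiE) auto

lemma expo_le: "expo I J i \<le> 2"
  by (simp add: expo_def)

lemma atMost_2: "{..2::nat} = {0, 1, 2}"
  by auto

lemma power_expansion: "e \<le> 2 \<Longrightarrow> x ^ e = (\<Sum>k\<le>2. eigen_coeff i e k * eigen_poly i k x)"
  by (auto simp: atMost_2 eigen_coeff_def eigen_poly_def le_Suc_eq numeral_2_eq_2)

text \<open>
  The carre du champ of two factors of one variable is \<open>s i * x + v i\<close> if both are \<open>x\<close>, and 0 if one of
  them is constant. Multiplying the \<open>k\<close>-th component of their product \<open>x ^ e\<close> by \<open>(e - k) / 2\<close> produces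
  it, which is the identity \<open>\<Gamma> = (L + 2 d) P\<^sup>2 / 2\<close> in one variable.
\<close>
lemma carre_du_champ_expansion:
  "e \<le> 2 \<Longrightarrow> (\<Sum>k\<le>2. eigen_coeff i e k * ((real e - real k) / 2) * eigen_poly i k x) = (if e = 2 then s i * x + v i else 0)"
  by (auto simp: atMost_2 eigen_coeff_def eigen_poly_def le_Suc_eq numeral_2_eq_2)

lemma prod_eq_prod_V:
  assumes "I \<subseteq> V"
  shows "(\<Prod>i\<in>I. x i) = (\<Prod>i\<in>V. x i ^ of_bool (i \<in> I) :: real)"
  by (rule prod.mono_neutral_cong_left) (use assms finite_V in auto)

text \<open>
  Every exponent is at most 2, so each variable of a product of two monomials is expanded separately
  and the product over \<open>V\<close> is multiplied out.
\<close>
lemma square_expansion: "(P x)\<^sup>2 = (\<Sum>\<kappa>\<in>multi_indices. square_coeff \<kappa> * eigen_prod \<kappa> x)"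
proof -
  have IJ: "(\<Prod>i\<in>I. x i) * (\<Prod>i\<in>J. x i) = (\<Sum>\<kappa>\<in>multi_indices. (\<Prod>i\<in>V. eigen_coeff i (expo I J i) (\<kappa> i)) * eigen_prod \<kappa> x)"
    if "I \<in> S" "J \<in> S" for I J
  proof -
    have "(\<Prod>i\<in>I. x i) * (\<Prod>i\<in>J. x i) = (\<Prod>i\<in>V. x i ^ expo I J i)"
      unfolding prod_eq_prod_V[OF S_sub[OF that(1)], of x] prod_eq_prod_V[OF S_sub[OF that(2)], of x]
      by (simp add: prod.distrib[symmetric] expo_def power_add)
    also have "\<dots> = (\<Prod>i\<in>V. \<Sum>k\<le>2. eigen_coeff i (expo I J i) k * eigen_poly i k (x i))"
      by (intro prod.cong refl power_expansion expo_le)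
    also have "\<dots> = (\<Sum>\<kappa>\<in>multi_indices. \<Prod>i\<in>V. eigen_coeff i (expo I J i) (\<kappa> i) * eigen_poly i (\<kappa> i) (x i))"
      unfolding multi_indices_def by (rule prod_sum_PiE) (use finite_V in auto)
    finally show ?thesis by (simp add: prod.distrib eigen_prod_def)
  qed
  have "(P x)\<^sup>2 = (\<Sum>I\<in>S. \<Sum>J\<in>S. c I * c J * ((\<Prod>i\<in>I. x i) * (\<Prod>i\<in>J. x i)))"
    unfolding power2_eq_square P_def sum_product by (intro sum.cong refl) (simp add: mult_ac)
  also have "\<dots> = (\<Sum>I\<in>S. \<Sum>J\<in>S. \<Sum>\<kappa>\<in>multi_indices. c I * c J * (\<Prod>i\<in>V. eigen_coeff i (expo I J i) (\<kappa> i)) * eigen_prod \<kappa> x)"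
    by (intro sum.cong refl) (simp add: IJ sum_distrib_left mult_ac)
  also have "\<dots> = (\<Sum>I\<in>S. \<Sum>\<kappa>\<in>multi_indices. \<Sum>J\<in>S. c I * c J * (\<Prod>i\<in>V. eigen_coeff i (expo I J i) (\<kappa> i)) * eigen_prod \<kappa> x)"
    by (intro sum.cong refl sum.swap)
  also have "\<dots> = (\<Sum>\<kappa>\<in>multi_indices. square_coeff \<kappa> * eigen_prod \<kappa> x)"
    unfolding square_coeff_def sum_distrib_right by (rule sum.swap)
  finally show ?thesis .
qed

lemma sum_expo:
  assumes "I \<in> S" "J \<in> S"
  shows "(\<Sum>i\<in>V. real (expo I J i)) = 2 * real d"
proof -
  have "(\<Sum>i\<in>V. real (of_bool (i \<in> I))) = real d" if "I \<in> S" for I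
  proof -
    have "V \<inter> I = I" using S_sub[OF that] by blast
    then show ?thesis
      using S_card[OF that] sum.inter_restrict[OF finite_V, of "\<lambda>_. 1::real" I]
      by (simp add: of_bool_def if_distrib cong: if_cong)
  qed
  then show ?thesis using assms by (simp add: expo_def sum.distrib)
qed

text \<open>
  For a pair of monomials, the \<open>i\<close>-th summand of \<open>\<Gamma>\<close> arises from their product when the factor of the
  variable \<open>i\<close> is replaced as in \<open>carre_du_champ_expansion\<close>, which inserts \<open>(e i - \<kappa> i) / 2\<close> in the
  component \<open>\<kappa>\<close>. The sum of these numbers over \<open>i\<close> is \<^term>\<open>weight \<kappa>\<close>, because the exponents add up
  to \<open>2 d\<close>.
\<close>
lemma \<Gamma>_expansion: "\<Gamma> x = (\<Sum>\<kappa>\<in>multi_indices. weight \<kappa> * square_coeff \<kappa> * eigen_prod \<kappa> x)"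
proof -
  define T where "T I J i = (if i \<in> I \<and> i \<in> J then
      (s i * x i + v i) * ((\<Prod>j\<in>I - {i}. x j) * (\<Prod>j\<in>J - {i}. x j)) else 0)" for I J i
  have T: "T I J i = (\<Sum>\<kappa>\<in>multi_indices. (real (expo I J i) - real (\<kappa> i)) / 2
      * (\<Prod>j\<in>V. eigen_coeff j (expo I J j) (\<kappa> j)) * eigen_prod \<kappa> x)"
    if "I \<in> S" "J \<in> S" "i \<in> V" for I J i
  proof -
    let ?e = "expo I J" and ?V = "V - {i}"
    have "(\<Prod>j\<in>I - {i}. x j) * (\<Prod>j\<in>J - {i}. x j) = (\<Prod>j\<in>?V. x j ^ ?e j)"
    proof -
      have "(\<Prod>j\<in>L - {i}. x j) = (\<Prod>j\<in>?V. x j ^ of_bool (j \<in> L))" if "L \<in> S" for L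
        by (rule prod.mono_neutral_cong_left) (use S_sub[OF that] finite_V in auto)
      then show ?thesis using that by (simp add: prod.distrib[symmetric] expo_def power_add)
    qed
    moreover have "?e i = 2 \<longleftrightarrow> i \<in> I \<and> i \<in> J" by (simp add: expo_def)
    ultimately have "T I J i = (\<Sum>k\<le>2. eigen_coeff i (?e i) k * ((real (?e i) - real k) / 2) * eigen_poly i k (x i)) * (\<Prod>j\<in>?V. x j ^ ?e j)"
      unfolding carre_du_champ_expansion[OF expo_le] by (simp add: T_def)
    also have "(\<Prod>j\<in>?V. x j ^ ?e j) = (\<Prod>j\<in>?V. \<Sum>k\<le>2. eigen_coeff j (?e j) k * (if j = i then (real (?e j) - real k) / 2 else 1) * eigen_poly j k (x j))"
      by (intro prod.cong refl) (simp add: power_expansion[OF expo_le])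
    also have "(\<Sum>k\<le>2. eigen_coeff i (?e i) k * ((real (?e i) - real k) / 2) * eigen_poly i k (x i)) * \<dots>
        = (\<Prod>j\<in>V. \<Sum>k\<le>2. eigen_coeff j (?e j) k * (if j = i then (real (?e j) - real k) / 2 else 1) * eigen_poly j k (x j))"
      using that(3) finite_V by (simp add: prod.remove[of V i])
    also have "\<dots> = (\<Sum>\<kappa>\<in>multi_indices. \<Prod>j\<in>V. eigen_coeff j (?e j) (\<kappa> j) * (if j = i then (real (?e j) - real (\<kappa> j)) / 2 else 1) * eigen_poly j (\<kappa> j) (x j))"
      unfolding multi_indices_def by (rule prod_sum_PiE) (use finite_V in auto)
    also have "\<dots> = (\<Sum>\<kappa>\<in>multi_indices. (real (?e i) - real (\<kappa> i)) / 2
      * (\<Prod>j\<in>V. eigen_coeff j (?e j) (\<kappa> j)) * eigen_prod \<kappa> x)"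
      using that(3) finite_V by (simp add: prod.distrib eigen_prod_def prod.delta mult_ac)
    finally show ?thesis .
  qed
  have IJ: "(\<Sum>i\<in>V. T I J i) = (\<Sum>\<kappa>\<in>multi_indices. weight \<kappa> * (\<Prod>j\<in>V. eigen_coeff j (expo I J j) (\<kappa> j)) * eigen_prod \<kappa> x)"
    if "I \<in> S" "J \<in> S" for I J
  proof -
    have "(\<Sum>i\<in>V. T I J i) = (\<Sum>i\<in>V. \<Sum>\<kappa>\<in>multi_indices. (real (expo I J i) - real (\<kappa> i)) / 2
      * (\<Prod>j\<in>V. eigen_coeff j (expo I J j) (\<kappa> j)) * eigen_prod \<kappa> x)"
      using T that by simp
    also have "\<dots> = (\<Sum>\<kappa>\<in>multi_indices. \<Sum>i\<in>V. (real (expo I J i) - real (\<kappa> i)) / 2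
      * (\<Prod>j\<in>V. eigen_coeff j (expo I J j) (\<kappa> j)) * eigen_prod \<kappa> x)"
      by (rule sum.swap)
    also have "\<dots> = (\<Sum>\<kappa>\<in>multi_indices. weight \<kappa> * (\<Prod>j\<in>V. eigen_coeff j (expo I J j) (\<kappa> j)) * eigen_prod \<kappa> x)"
      unfolding sum_distrib_right[symmetric] sum_divide_distrib[symmetric] sum_subtractf sum_expo[OF that]
      by (simp add: weight_def diff_divide_distrib)
    finally show ?thesis .
  qed
  have "\<Gamma> x = (\<Sum>i\<in>V. \<Sum>I\<in>S. \<Sum>J\<in>S. c I * c J * T I J i)"
  proof -
    have "(s i * x i + v i) * (partial i x)\<^sup>2 = (\<Sum>I\<in>S. \<Sum>J\<in>S. c I * c J * T I J i)" for i
    proof -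
      have "(partial i x)\<^sup>2 = (\<Sum>I\<in>S. \<Sum>J\<in>S.
          (if i \<in> I then c I * (\<Prod>j\<in>I - {i}. x j) else 0) * (if i \<in> J then c J * (\<Prod>j\<in>J - {i}. x j) else 0))"
        unfolding power2_eq_square partial_def by (rule sum_product)
      then show ?thesis
        unfolding sum_distrib_left by (simp only:) (auto intro!: sum.cong simp: T_def sum_distrib_left)
    qed
    then show ?thesis by (simp add: \<Gamma>_def)
  qed
  also have "\<dots> = (\<Sum>I\<in>S. \<Sum>i\<in>V. \<Sum>J\<in>S. c I * c J * T I J i)"
    by (rule sum.swap)
  also have "\<dots> = (\<Sum>I\<in>S. \<Sum>J\<in>S. \<Sum>i\<in>V. c I * c J * T I J i)"
    by (intro sum.cong refl sum.swap)
  also have "\<dots> = (\<Sum>I\<in>S. \<Sum>J\<in>S. \<Sum>\<kappa>\<in>multi_indices. weight \<kappa> * (c I * c J * (\<Prod>i\<in>V. eigen_coeff i (expo I J i) (\<kappa> i))) * eigen_prod \<kappa> x)"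
    by (intro sum.cong refl) (simp add: IJ sum_distrib_left[symmetric], simp add: sum_distrib_left mult_ac)
  also have "\<dots> = (\<Sum>I\<in>S. \<Sum>\<kappa>\<in>multi_indices. \<Sum>J\<in>S. weight \<kappa> * (c I * c J * (\<Prod>i\<in>V. eigen_coeff i (expo I J i) (\<kappa> i))) * eigen_prod \<kappa> x)"
    by (intro sum.cong refl sum.swap)
  also have "\<dots> = (\<Sum>\<kappa>\<in>multi_indices. weight \<kappa> * square_coeff \<kappa> * eigen_prod \<kappa> x)"
    unfolding square_coeff_def sum_distrib_right sum_distrib_left by (rule sum.swap)
  finally show ?thesis .
qed

lemma eigen_poly_measurable [measurable]: "eigen_poly i k \<in> borel_measurable borel"
  unfolding eigen_poly_def[abs_def] by measurable

lemma all_moments_eigen_poly: "all_moments M (\<lambda>\<omega>. eigen_poly i k (X i \<omega>))"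
  unfolding eigen_poly_def
  by (cases "k = 0"; cases "k = 1")
     (auto intro!: all_moments_intros all_moments_X prob_space_axioms simp del: One_nat_def)

lemma all_moments_eigen_prod: "all_moments M (\<lambda>\<omega>. eigen_prod \<kappa> (W \<omega>))"
  unfolding eigen_prod_def by (intro all_moments_intros all_moments_eigen_poly prob_space_axioms)

lemma X_moments: "expectation (X i) = 0" "expectation (\<lambda>\<omega>. X i \<omega> ^ 2) = v i"
  "expectation (\<lambda>\<omega>. X i \<omega> ^ 3) = 2 * s i * v i"
proof -
  have "prob_space (distr M borel (X i))" by (rule prob_space_distr) simp
  from stein_law_moments[OF stein this]
  show "expectation (X i) = 0" "expectation (\<lambda>\<omega>. X i \<omega> ^ 2) = v i"
    "expectation (\<lambda>\<omega>. X i \<omega> ^ 3) = 2 * s i * v i"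
    by (simp_all add: integral_distr)
qed

lemma eigen_poly_orthogonal:
  assumes "j \<noteq> k" "j \<le> 2" "k \<le> 2"
  shows "expectation (\<lambda>\<omega>. eigen_poly i j (X i \<omega>) * eigen_poly i k (X i \<omega>)) = 0"
proof -
  note [simp] = X_moments prob_space
  have int [simp]: "integrable M (\<lambda>\<omega>. X i \<omega> ^ n)" for n
    by (intro all_moments_integrable all_moments_intros all_moments_X prob_space_axioms)
  have [simp]: "integrable M (X i)" using int[of 1] by simp
  have 01: "expectation (\<lambda>\<omega>. eigen_poly i 0 (X i \<omega>) * eigen_poly i 1 (X i \<omega>)) = 0"
    by (simp add: eigen_poly_def)
  have 02: "expectation (\<lambda>\<omega>. eigen_poly i 0 (X i \<omega>) * eigen_poly i 2 (X i \<omega>)) = 0"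
    by (simp add: eigen_poly_def)
  have "expectation (\<lambda>\<omega>. eigen_poly i 1 (X i \<omega>) * eigen_poly i 2 (X i \<omega>))
      = expectation (\<lambda>\<omega>. X i \<omega> ^ 3 - 2 * s i * X i \<omega> ^ 2 - v i * X i \<omega>)"
    by (simp add: eigen_poly_def power2_eq_square power3_eq_cube algebra_simps)
  also have "\<dots> = 0" by simp
  finally have 12: "expectation (\<lambda>\<omega>. eigen_poly i 1 (X i \<omega>) * eigen_poly i 2 (X i \<omega>)) = 0" .
  have "j \<in> {0, 1, 2}" "k \<in> {0, 1, 2}" using assms by auto
  then show ?thesis
    using assms(1) 01 02 12 by (auto simp: mult.commute)
qed

text \<open>
  By independence the expectation factorizes, and a variable on which the multi-indices differ
  contributes a factor 0.
\<close>
lemma eigen_prod_orthogonal: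
  assumes "\<kappa> \<in> multi_indices" "\<kappa>' \<in> multi_indices" "\<kappa> \<noteq> \<kappa>'"
  shows "expectation (\<lambda>\<omega>. eigen_prod \<kappa> (W \<omega>) * eigen_prod \<kappa>' (W \<omega>)) = 0"
proof -
  let ?f = "\<lambda>i x. eigen_poly i (\<kappa> i) x * eigen_poly i (\<kappa>' i) x"
  have "expectation (\<lambda>\<omega>. eigen_prod \<kappa> (W \<omega>) * eigen_prod \<kappa>' (W \<omega>)) = expectation (\<lambda>\<omega>. \<Prod>i\<in>V. ?f i (X i \<omega>))"
    by (simp add: eigen_prod_def prod.distrib)
  also have "\<dots> = (\<Prod>i\<in>V. expectation (\<lambda>\<omega>. ?f i (X i \<omega>)))"
  proof (rule indep_vars_lebesgue_integral[OF finite_V])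
    show "indep_vars (\<lambda>_. borel) (\<lambda>i \<omega>. ?f i (X i \<omega>)) V"
      by (rule indep_vars_compose2[OF indep_vars_subset[OF indep]]) auto
    show "integrable M (\<lambda>\<omega>. ?f i (X i \<omega>))" for i
      by (intro all_moments_integrable all_moments_mult all_moments_eigen_poly)
  qed
  also have "\<dots> = 0"
  proof -
    obtain i where i: "i \<in> V" "\<kappa> i \<noteq> \<kappa>' i"
      using assms unfolding multi_indices_def by (metis PiE_ext)
    then have "\<kappa> i \<le> 2" "\<kappa>' i \<le> 2" using assms unfolding multi_indices_def by (auto dest: PiE_mem)
    then show ?thesis using i finite_V eigen_poly_orthogonal by (intro prod_zero) auto
  qed
  finally show ?thesis .
qed

text \<open>
  By orthogonality the expectation is the sum of \<open>weight \<kappa> * (d - weight \<kappa>) * (square_coeff \<kappa>)\<^sup>2\<close>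
  times the squared norm of \<^term>\<open>eigen_prod \<kappa>\<close>. The second factor is half the sum of \<open>\<kappa>\<close>, and the
  first is nonnegative on the multi-indices that occur in \<open>P\<^sup>2\<close>, since those have sum at most \<open>2 d\<close>.
\<close>
lemma spectral_inequality:
  "0 \<le> expectation (\<lambda>\<omega>. \<Gamma> (W \<omega>) * (real d * (P (W \<omega>))\<^sup>2 - \<Gamma> (W \<omega>)))"
proof -
  define N where "N \<kappa> = expectation (\<lambda>\<omega>. eigen_prod \<kappa> (W \<omega>) * eigen_prod \<kappa> (W \<omega>))" for \<kappa>
  have int: "integrable M (\<lambda>\<omega>. a * (eigen_prod \<kappa> (W \<omega>) * eigen_prod \<kappa>' (W \<omega>)))" for a \<kappa> \<kappa>'
    by (intro all_moments_integrable all_moments_intros all_moments_eigen_prod prob_space_axioms)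
  have "\<Gamma> x * (real d * (P x)\<^sup>2 - \<Gamma> x)
      = (\<Sum>\<kappa>\<in>multi_indices. \<Sum>\<kappa>'\<in>multi_indices. weight \<kappa> * square_coeff \<kappa> * ((real d - weight \<kappa>') * square_coeff \<kappa>') * (eigen_prod \<kappa> x * eigen_prod \<kappa>' x))" for x
  proof -
    have "real d * (P x)\<^sup>2 - \<Gamma> x = (\<Sum>\<kappa>\<in>multi_indices. (real d - weight \<kappa>) * square_coeff \<kappa> * eigen_prod \<kappa> x)"
      unfolding square_expansion \<Gamma>_expansion sum_distrib_left sum_subtractf[symmetric]
      by (intro sum.cong refl) (simp add: algebra_simps)
    then show ?thesis
      unfolding \<Gamma>_expansion by (simp add: sum_product mult_ac)
  qed
  then have "expectation (\<lambda>\<omega>. \<Gamma> (W \<omega>) * (real d * (P (W \<omega>))\<^sup>2 - \<Gamma> (W \<omega>)))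
      = expectation (\<lambda>\<omega>. \<Sum>\<kappa>\<in>multi_indices. \<Sum>\<kappa>'\<in>multi_indices. weight \<kappa> * square_coeff \<kappa> * ((real d - weight \<kappa>') * square_coeff \<kappa>') * (eigen_prod \<kappa> (W \<omega>) * eigen_prod \<kappa>' (W \<omega>)))"
    by simp
  also have "\<dots> = (\<Sum>\<kappa>\<in>multi_indices. \<Sum>\<kappa>'\<in>multi_indices. weight \<kappa> * square_coeff \<kappa> * ((real d - weight \<kappa>') * square_coeff \<kappa>') * expectation (\<lambda>\<omega>. eigen_prod \<kappa> (W \<omega>) * eigen_prod \<kappa>' (W \<omega>)))"
    by (simp only: Bochner_Integration.integral_sum Bochner_Integration.integrable_sum int integral_mult_right_zero)
  also have "\<dots> = (\<Sum>\<kappa>\<in>multi_indices. \<Sum>\<kappa>'\<in>multi_indices. if \<kappa>' = \<kappa> then weight \<kappa> * square_coeff \<kappa> * ((real d - weight \<kappa>) * square_coeff \<kappa>) * N \<kappa> else 0)"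
    by (intro sum.cong refl) (auto simp: eigen_prod_orthogonal N_def)
  also have "\<dots> = (\<Sum>\<kappa>\<in>multi_indices. weight \<kappa> * square_coeff \<kappa> * ((real d - weight \<kappa>) * square_coeff \<kappa>) * N \<kappa>)"
    using finite_multi_indices by simp
  also have "\<dots> \<ge> 0"
  proof (intro sum_nonneg)
    fix \<kappa> assume \<kappa>: "\<kappa> \<in> multi_indices"
    have N: "N \<kappa> \<ge> 0" unfolding N_def by (intro Bochner_Integration.integral_nonneg) simp
    have dw: "real d - weight \<kappa> \<ge> 0" by (simp add: weight_def sum_nonneg)
    \<comment> \<open>a multi-index with nonzero coefficient is dominated by the exponents of a pair of monomials\<close>
    have wC: "0 \<le> weight \<kappa> * (square_coeff \<kappa>)\<^sup>2"
    proof (cases "square_coeff \<kappa> = 0")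
      case False
      obtain I J where IJ: "I \<in> S" "J \<in> S" "(\<Prod>i\<in>V. eigen_coeff i (expo I J i) (\<kappa> i)) \<noteq> 0"
      proof (rule ccontr)
        assume "\<not> thesis"
        with that have "square_coeff \<kappa> = 0" unfolding square_coeff_def by (intro sum.neutral ballI) auto
        with False show False by simp
      qed
      have "\<kappa> i \<le> expo I J i" if i: "i \<in> V" for i
      proof -
        have "eigen_coeff i (expo I J i) (\<kappa> i) \<noteq> 0" using IJ(3) finite_V i by auto
        moreover have "\<kappa> i \<le> 2" using \<kappa> i unfolding multi_indices_def by (auto dest: PiE_mem)
        ultimately show ?thesis by (auto simp: eigen_coeff_def split: if_splits)
      qed
      then have "(\<Sum>i\<in>V. real (\<kappa> i)) \<le> (\<Sum>i\<in>V. real (expo I J i))" by (intro sum_mono) simp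
      then have "0 \<le> weight \<kappa>" using sum_expo[OF IJ(1,2)] by (simp add: weight_def)
      then show ?thesis by simp
    qed simp
    have "0 \<le> weight \<kappa> * (square_coeff \<kappa>)\<^sup>2 * (real d - weight \<kappa>) * N \<kappa>"
      by (rule mult_nonneg_nonneg[OF mult_nonneg_nonneg[OF wC dw] N])
    then show "0 \<le> weight \<kappa> * square_coeff \<kappa> * ((real d - weight \<kappa>) * square_coeff \<kappa>) * N \<kappa>"
      by (simp add: power2_eq_square mult_ac)
  qed
  finally show ?thesis .
qed

text \<open>
  Integration by parts with \<open>x\<close> and \<open>x\<^sup>3\<close> gives \<open>E[\<Gamma>] = d E[P\<^sup>2]\<close> and \<open>E[\<Gamma> P\<^sup>2] = d E[P\<^sup>4] / 3\<close>; the
  spectral inequality bounds \<open>E[\<Gamma>\<^sup>2]\<close> by the latter.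
\<close>
lemma stein_kernel_variance:
  assumes "1 \<le> d"
  shows "expectation (\<lambda>\<omega>. (\<Gamma> (W \<omega>) / real d - 1)\<^sup>2)
    \<le> expectation (\<lambda>\<omega>. P (W \<omega>) ^ 4) / 3 - 2 * expectation (\<lambda>\<omega>. P (W \<omega>) ^ 2) + 1"
proof -
  have d: "real d > 0" using assms by simp
  note am = all_moments_integrable all_moments_intros prob_space_axioms all_moments_P all_moments_\<Gamma>
  have growth: "cubic_growth (\<lambda>_. 1)" "cubic_growth (\<lambda>x. x)" "cubic_growth (\<lambda>x. x ^ 3)" "cubic_growth (\<lambda>x. 3 * x\<^sup>2)"
    using cubic_growth_monomial[of 0 1] cubic_growth_monomial[of 1 1]
      cubic_growth_monomial[of 3 1] cubic_growth_monomial[of 2 3] by simp_all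
  have int\<Gamma>: "integrable M (\<lambda>\<omega>. \<Gamma> (W \<omega>))" "integrable M (\<lambda>\<omega>. \<Gamma> (W \<omega>) ^ 2)"
    "integrable M (\<lambda>\<omega>. \<Gamma> (W \<omega>) * (P (W \<omega>))\<^sup>2)"
    by (intro am)+
  have E1: "expectation (\<lambda>\<omega>. \<Gamma> (W \<omega>)) = real d * expectation (\<lambda>\<omega>. P (W \<omega>) ^ 2)"
    using integration_by_parts[of "\<lambda>x. x" "\<lambda>_. 1"] growth by (simp add: power2_eq_square)
  have "real d * expectation (\<lambda>\<omega>. P (W \<omega>) * P (W \<omega>) ^ 3) = expectation (\<lambda>\<omega>. \<Gamma> (W \<omega>) * (3 * (P (W \<omega>))\<^sup>2))"
    by (rule integration_by_parts) (auto intro!: derivative_eq_intros continuous_intros growth)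
  moreover have "x * x ^ 3 = x ^ 4" for x :: real by (simp add: power_numeral_reduce)
  ultimately have E2: "expectation (\<lambda>\<omega>. \<Gamma> (W \<omega>) * (P (W \<omega>))\<^sup>2) = real d * expectation (\<lambda>\<omega>. P (W \<omega>) ^ 4) / 3"
    by (simp only: mult.left_commute[of _ 3] integral_mult_right_zero)
  have "expectation (\<lambda>\<omega>. \<Gamma> (W \<omega>) * (real d * (P (W \<omega>))\<^sup>2 - \<Gamma> (W \<omega>)))
      = expectation (\<lambda>\<omega>. real d * (\<Gamma> (W \<omega>) * (P (W \<omega>))\<^sup>2) - \<Gamma> (W \<omega>) ^ 2)"
    by (simp add: algebra_simps power2_eq_square)
  also have "\<dots> = real d * expectation (\<lambda>\<omega>. \<Gamma> (W \<omega>) * (P (W \<omega>))\<^sup>2) - expectation (\<lambda>\<omega>. \<Gamma> (W \<omega>) ^ 2)"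
    using int\<Gamma> by simp
  finally have E3: "expectation (\<lambda>\<omega>. \<Gamma> (W \<omega>) ^ 2) \<le> (real d)\<^sup>2 * expectation (\<lambda>\<omega>. P (W \<omega>) ^ 4) / 3"
    using spectral_inequality unfolding E2 by (simp add: power2_eq_square[of "real d"])
  have "expectation (\<lambda>\<omega>. (\<Gamma> (W \<omega>) / real d - 1)\<^sup>2)
      = expectation (\<lambda>\<omega>. (1 / (real d)\<^sup>2) * \<Gamma> (W \<omega>) ^ 2 + ((- 2 / real d) * \<Gamma> (W \<omega>) + 1))"
    by (simp add: power2_diff power_divide add_diff_eq)
  also have "\<dots> = (1 / (real d)\<^sup>2) * expectation (\<lambda>\<omega>. \<Gamma> (W \<omega>) ^ 2) + ((- 2 / real d) * expectation (\<lambda>\<omega>. \<Gamma> (W \<omega>)) + 1)"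
    using int\<Gamma> prob_space by simp
  also have "\<dots> \<le> (1 / (real d)\<^sup>2) * ((real d)\<^sup>2 * expectation (\<lambda>\<omega>. P (W \<omega>) ^ 4) / 3) + ((- 2 / real d) * expectation (\<lambda>\<omega>. \<Gamma> (W \<omega>)) + 1)"
    using E3 by (intro add_right_mono mult_left_mono) auto
  also have "\<dots> = expectation (\<lambda>\<omega>. P (W \<omega>) ^ 4) / 3 - 2 * expectation (\<lambda>\<omega>. P (W \<omega>) ^ 2) + 1"
    using d by (simp add: E1)
  finally show ?thesis .
qed

end

section \<open>A central limit theorem from Stein kernels\<close>

text \<open>
  The real part of the first-order Taylor expansion of \<open>exp (i (x + h))\<close> in \<open>h\<close>.
\<close>
lemma cos_taylor: "\<bar>cos (x + h) - cos x + h * sin x\<bar> \<le> h\<^sup>2 / 2" for x h :: real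
proof -
  have "cos (x + h) - cos x + h * sin x = Re (iexp x * (iexp h - (\<Sum>k\<le>1. (\<i> * h) ^ k / fact k)))"
    by (simp add: cos_add Re_exp Im_exp algebra_simps)
  also have "\<bar>\<dots>\<bar> \<le> cmod (iexp x * (iexp h - (\<Sum>k\<le>1. (\<i> * h) ^ k / fact k)))"
    by (rule abs_Re_le_cmod)
  also have "\<dots> \<le> h\<^sup>2 / 2"
    using iexp_approx1[of h 1] by (simp add: norm_mult numeral_2_eq_2)
  finally show ?thesis .
qed

lemma has_real_derivative_quadratic_error:
  fixes u :: "real \<Rightarrow> real"
  assumes "\<And>h. \<bar>u (t + h) - u t - h * D\<bar> \<le> B * h\<^sup>2"
  shows "(u has_real_derivative D) (at t)"
  unfolding DERIV_def
proof (rule LIM_zero_cancel, rule Lim_null_comparison)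
  show "((\<lambda>h. B * \<bar>h\<bar>) \<longlongrightarrow> 0) (at 0)"
    by (rule tendsto_eq_intros | simp)+
  show "\<forall>\<^sub>F h in at 0. norm ((u (t + h) - u t) / h - D) \<le> B * \<bar>h\<bar>"
    unfolding eventually_at_filter
  proof (intro always_eventually allI impI)
    fix h :: real assume "h \<noteq> 0"
    then have "norm ((u (t + h) - u t) / h - D) = \<bar>u (t + h) - u t - h * D\<bar> / \<bar>h\<bar>"
      by (simp add: abs_divide[symmetric] diff_divide_distrib)
    also have "\<dots> \<le> B * h\<^sup>2 / \<bar>h\<bar>" by (intro divide_right_mono assms) auto
    also have "\<dots> = B * \<bar>h\<bar>" using \<open>h \<noteq> 0\<close> by (simp add: power2_eq_square field_simps)
    finally show "norm ((u (t + h) - u t) / h - D) \<le> B * \<bar>h\<bar>" .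
  qed
qed

text \<open>
  The Taylor error of the integrand is at most \<open>h\<^sup>2 F\<^sup>2 / 2\<close>, and its expectation is again quadratic
  in \<open>h\<close>.
\<close>
lemma (in prob_space) expectation_cos_derivative:
  assumes "all_moments M F"
  shows "((\<lambda>t. expectation (\<lambda>\<omega>. cos (t * F \<omega> + \<theta>))) has_real_derivative
           - expectation (\<lambda>\<omega>. F \<omega> * sin (t * F \<omega> + \<theta>))) (at t)"
proof (rule has_real_derivative_quadratic_error)
  fix h
  note [measurable] = all_moments_measurable[OF assms]
  have intc: "integrable M (\<lambda>\<omega>. cos (t * F \<omega> + \<theta>))" for t
    by (rule integrable_const_bound[of _ 1]) auto
  have ints: "integrable M (\<lambda>\<omega>. F \<omega> * sin (t * F \<omega> + \<theta>))"
    by (rule Bochner_Integration.integrable_bound[OF all_moments_integrable[OF assms]])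
       (auto simp: abs_mult mult_left_le)
  have int2: "integrable M (\<lambda>\<omega>. F \<omega> ^ 2)"
    by (intro all_moments_integrable all_moments_power assms prob_space_axioms)
  let ?g = "\<lambda>\<omega>. cos ((t + h) * F \<omega> + \<theta>) - cos (t * F \<omega> + \<theta>) + h * (F \<omega> * sin (t * F \<omega> + \<theta>))"
  have intg: "integrable M ?g"
    using intc ints by (intro Bochner_Integration.integrable_add Bochner_Integration.integrable_diff integrable_mult_right)
  have eq: "expectation (\<lambda>\<omega>. cos ((t + h) * F \<omega> + \<theta>)) - expectation (\<lambda>\<omega>. cos (t * F \<omega> + \<theta>))
      - h * - expectation (\<lambda>\<omega>. F \<omega> * sin (t * F \<omega> + \<theta>)) = expectation ?g"
    using intc ints by simp
  have "\<bar>expectation ?g\<bar> \<le> expectation (\<lambda>\<omega>. \<bar>?g \<omega>\<bar>)" by (rule integral_abs_bound)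
  also have "\<dots> \<le> expectation (\<lambda>\<omega>. h\<^sup>2 / 2 * F \<omega> ^ 2)"
  proof (rule integral_mono)
    show "\<bar>?g \<omega>\<bar> \<le> h\<^sup>2 / 2 * F \<omega> ^ 2" for \<omega>
    proof -
      have "(t + h) * F \<omega> + \<theta> = (t * F \<omega> + \<theta>) + h * F \<omega>" by (simp add: distrib_right)
      moreover have "(h * F \<omega>)\<^sup>2 / 2 = h\<^sup>2 / 2 * F \<omega> ^ 2" by (simp add: power_mult_distrib)
      ultimately show ?thesis
        using cos_taylor[of "t * F \<omega> + \<theta>" "h * F \<omega>"] by (simp only: mult.assoc)
    qed
  qed (intro integrable_abs intg integrable_mult_right int2)+
  also have "\<dots> = expectation (\<lambda>\<omega>. F \<omega> ^ 2) / 2 * h\<^sup>2" by simp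
  finally show "\<bar>expectation (\<lambda>\<omega>. cos ((t + h) * F \<omega> + \<theta>)) - expectation (\<lambda>\<omega>. cos (t * F \<omega> + \<theta>))
      - h * - expectation (\<lambda>\<omega>. F \<omega> * sin (t * F \<omega> + \<theta>))\<bar> \<le> expectation (\<lambda>\<omega>. F \<omega> ^ 2) / 2 * h\<^sup>2"
    by (simp only: eq)
qed

lemma (in prob_space) expectation_abs_le_sqrt:
  assumes "all_moments M Y"
  shows "expectation (\<lambda>\<omega>. \<bar>Y \<omega>\<bar>) \<le> sqrt (expectation (\<lambda>\<omega>. (Y \<omega>)\<^sup>2))"
proof (rule real_le_rsqrt)
  have "0 \<le> variance (\<lambda>\<omega>. \<bar>Y \<omega>\<bar>)" by (rule variance_positive)
  also have "\<dots> = expectation (\<lambda>\<omega>. \<bar>Y \<omega>\<bar>\<^sup>2) - (expectation (\<lambda>\<omega>. \<bar>Y \<omega>\<bar>))\<^sup>2"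
    by (rule variance_eq)
       (intro all_moments_integrable all_moments_power all_moments_abs assms prob_space_axioms)+
  finally show "(expectation (\<lambda>\<omega>. \<bar>Y \<omega>\<bar>))\<^sup>2 \<le> expectation (\<lambda>\<omega>. (Y \<omega>)\<^sup>2)" by simp
qed

text \<open>
  Let \<open>u t = E[cos (t F + \<theta>)]\<close>. The hypothesis says \<open>u' t = - t E[G cos (t F + \<theta>)]\<close>, so the derivative
  of \<open>u t * exp (t\<^sup>2 / 2)\<close> is \<open>t exp (t\<^sup>2 / 2) E[(1 - G) cos (t F + \<theta>)]\<close>, which is small if \<open>G\<close> is close
  to 1. The phase \<open>\<theta>\<close> treats the real and the imaginary part of the characteristic function at once.
\<close>
lemma (in prob_space) expectation_cos_near_gaussian:
  assumes F: "all_moments M F" and G: "all_moments M G"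
    and stein: "\<And>t. expectation (\<lambda>\<omega>. F \<omega> * sin (t * F \<omega> + \<theta>)) = t * expectation (\<lambda>\<omega>. G \<omega> * cos (t * F \<omega> + \<theta>))"
  shows "\<bar>expectation (\<lambda>\<omega>. cos (t * F \<omega> + \<theta>)) - cos \<theta> * exp (- t\<^sup>2 / 2)\<bar>
    \<le> t\<^sup>2 * sqrt (expectation (\<lambda>\<omega>. (G \<omega> - 1)\<^sup>2))"
proof -
  note [measurable] = all_moments_measurable[OF F] all_moments_measurable[OF G]
  define \<delta> where "\<delta> = sqrt (expectation (\<lambda>\<omega>. (G \<omega> - 1)\<^sup>2))"
  define u where "u t = expectation (\<lambda>\<omega>. cos (t * F \<omega> + \<theta>))" for t
  define h where "h t = u t * exp (t\<^sup>2 / 2)" for t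
  define r where "r t = t * exp (t\<^sup>2 / 2) * expectation (\<lambda>\<omega>. (1 - G \<omega>) * cos (t * F \<omega> + \<theta>))" for t
  have \<delta>0: "\<delta> \<ge> 0" by (simp add: \<delta>_def)
  have intc: "integrable M (\<lambda>\<omega>. cos (t * F \<omega> + \<theta>))" for t
    by (rule integrable_const_bound[of _ 1]) auto
  have intG: "integrable M (\<lambda>\<omega>. G \<omega> * cos (t * F \<omega> + \<theta>))" for t
    by (rule Bochner_Integration.integrable_bound[OF all_moments_integrable[OF G]])
       (auto simp: abs_mult mult_left_le)
  have "(h has_real_derivative r t) (at t)" for t
  proof -
    have "(h has_real_derivative - expectation (\<lambda>\<omega>. F \<omega> * sin (t * F \<omega> + \<theta>)) * exp (t\<^sup>2 / 2)
        + u t * (exp (t\<^sup>2 / 2) * t)) (at t)"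
    proof -
      have "((\<lambda>t. exp (t\<^sup>2 / 2)) has_real_derivative exp (t\<^sup>2 / 2) * t) (at t)"
        by (auto intro!: derivative_eq_intros)
      from DERIV_mult[OF expectation_cos_derivative[OF F, of \<theta> t] this]
      show ?thesis by (simp add: h_def[abs_def] u_def mult_ac)
    qed
    also have "- expectation (\<lambda>\<omega>. F \<omega> * sin (t * F \<omega> + \<theta>)) * exp (t\<^sup>2 / 2) + u t * (exp (t\<^sup>2 / 2) * t)
        = t * exp (t\<^sup>2 / 2) * (u t - expectation (\<lambda>\<omega>. G \<omega> * cos (t * F \<omega> + \<theta>)))"
      unfolding stein by (simp add: algebra_simps)
    also have "\<dots> = r t"
      using intc intG by (simp add: r_def u_def left_diff_distrib)
    finally show ?thesis .
  qed
  note deriv = this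
  have bound: "\<bar>r x\<bar> \<le> \<bar>t\<bar> * exp (t\<^sup>2 / 2) * \<delta>" if "\<bar>x\<bar> \<le> \<bar>t\<bar>" for x
  proof -
    have am: "all_moments M (\<lambda>\<omega>. G \<omega> - 1)"
      by (intro all_moments_intros G prob_space_axioms)
    have "\<bar>expectation (\<lambda>\<omega>. (1 - G \<omega>) * cos (x * F \<omega> + \<theta>))\<bar>
        \<le> expectation (\<lambda>\<omega>. \<bar>(1 - G \<omega>) * cos (x * F \<omega> + \<theta>)\<bar>)" by (rule integral_abs_bound)
    also have "\<dots> \<le> expectation (\<lambda>\<omega>. \<bar>G \<omega> - 1\<bar>)"
    proof (rule integral_mono)
      show "integrable M (\<lambda>\<omega>. \<bar>(1 - G \<omega>) * cos (x * F \<omega> + \<theta>)\<bar>)"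
        using intc intG by (intro integrable_abs) (simp add: left_diff_distrib)
      show "integrable M (\<lambda>\<omega>. \<bar>G \<omega> - 1\<bar>)" using am by (intro all_moments_integrable all_moments_abs)
      show "\<bar>(1 - G \<omega>) * cos (x * F \<omega> + \<theta>)\<bar> \<le> \<bar>G \<omega> - 1\<bar>" for \<omega>
        by (simp add: abs_mult abs_minus_commute mult_left_le)
    qed
    also have "\<dots> \<le> \<delta>" unfolding \<delta>_def by (rule expectation_abs_le_sqrt[OF am])
    finally have 1: "\<bar>expectation (\<lambda>\<omega>. (1 - G \<omega>) * cos (x * F \<omega> + \<theta>))\<bar> \<le> \<delta>" .
    have "x\<^sup>2 \<le> t\<^sup>2" using that by (simp add: abs_le_square_iff)
    then have "\<bar>x\<bar> * exp (x\<^sup>2 / 2) \<le> \<bar>t\<bar> * exp (t\<^sup>2 / 2)"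
      using that by (intro mult_mono) auto
    with 1 show ?thesis unfolding r_def abs_mult abs_exp_cancel by (intro mult_mono[of "_ * _"]) auto
  qed
  have "norm (h t - h 0) \<le> (\<bar>t\<bar> * exp (t\<^sup>2 / 2) * \<delta>) * norm (t - 0)"
  proof (rule field_differentiable_bound)
    show "convex (closed_segment 0 t)" by (rule convex_closed_segment)
    show "(h has_real_derivative r x) (at x within closed_segment 0 t)" for x
      by (rule has_field_derivative_at_within[OF deriv])
    show "norm (r x) \<le> \<bar>t\<bar> * exp (t\<^sup>2 / 2) * \<delta>" if "x \<in> closed_segment 0 t" for x
      using bound[of x] segment_bound1[OF that] by simp
  qed auto
  moreover have "h 0 = cos \<theta>" by (simp add: h_def u_def prob_space)
  ultimately have "\<bar>h t - cos \<theta>\<bar> \<le> t\<^sup>2 * \<delta> * exp (t\<^sup>2 / 2)"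
    by (simp add: power2_eq_square abs_mult[symmetric] mult_ac)
  then have "\<bar>h t - cos \<theta>\<bar> * exp (- t\<^sup>2 / 2) \<le> t\<^sup>2 * \<delta> * exp (t\<^sup>2 / 2) * exp (- t\<^sup>2 / 2)"
    by (intro mult_right_mono) auto
  moreover have e: "exp (t\<^sup>2 / 2) * exp (- t\<^sup>2 / 2) = 1"
    by (simp add: exp_add[symmetric])
  moreover have "\<bar>h t - cos \<theta>\<bar> * exp (- t\<^sup>2 / 2) = \<bar>(h t - cos \<theta>) * exp (- t\<^sup>2 / 2)\<bar>"
    by (simp add: abs_mult)
  moreover have "(h t - cos \<theta>) * exp (- t\<^sup>2 / 2) = u t - cos \<theta> * exp (- t\<^sup>2 / 2)"
    using e by (simp add: h_def left_diff_distrib mult.assoc)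
  moreover have "t\<^sup>2 * \<delta> * exp (t\<^sup>2 / 2) * exp (- t\<^sup>2 / 2) = t\<^sup>2 * \<delta>"
    by (simp only: mult.assoc e mult_1_right)
  ultimately show ?thesis unfolding u_def[symmetric] \<delta>_def[symmetric] by (simp only:)
qed

text \<open>
  The hypothesis on \<open>G\<close> is the Stein identity of \<open>F\<close> with kernel \<open>G\<close>, restricted to trigonometric test
  functions; a kernel equal to 1 characterizes the standard Gaussian law.
\<close>
theorem (in prob_space) stein_kernel_clt:
  assumes F: "\<And>n. all_moments M (F n)" and G: "\<And>n. all_moments M (G n)"
    and stein: "\<And>n t \<theta>. expectation (\<lambda>\<omega>. F n \<omega> * sin (t * F n \<omega> + \<theta>))
        = t * expectation (\<lambda>\<omega>. G n \<omega> * cos (t * F n \<omega> + \<theta>))"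
    and lim: "(\<lambda>n. expectation (\<lambda>\<omega>. (G n \<omega> - 1)\<^sup>2)) \<longlonglongrightarrow> 0"
  shows "weak_conv_m (\<lambda>n. distr M borel (F n)) std_normal_distribution"
proof (rule levy_continuity)
  note [measurable] = all_moments_measurable[OF F]
  show "real_distribution (distr M borel (F n))" for n
    by (rule real_distribution_distr) simp
  show "real_distribution std_normal_distribution" by (rule real_dist_normal_dist)
  fix t :: real
  have conv: "(\<lambda>n. expectation (\<lambda>\<omega>. cos (t * F n \<omega> + \<theta>))) \<longlonglongrightarrow> cos \<theta> * exp (- t\<^sup>2 / 2)" for \<theta>
  proof (rule LIM_zero_cancel, rule Lim_null_comparison)
    show "\<forall>\<^sub>F n in sequentially. norm (expectation (\<lambda>\<omega>. cos (t * F n \<omega> + \<theta>)) - cos \<theta> * exp (- t\<^sup>2 / 2))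
        \<le> t\<^sup>2 * sqrt (expectation (\<lambda>\<omega>. (G n \<omega> - 1)\<^sup>2))"
      using expectation_cos_near_gaussian[OF F G stein] by simp
    show "(\<lambda>n. t\<^sup>2 * sqrt (expectation (\<lambda>\<omega>. (G n \<omega> - 1)\<^sup>2))) \<longlonglongrightarrow> 0"
      using tendsto_mult_right_zero[OF tendsto_real_sqrt[OF lim, simplified]] .
  qed
  have char: "char (distr M borel (F n)) t
      = Complex (expectation (\<lambda>\<omega>. cos (t * F n \<omega> + 0))) (expectation (\<lambda>\<omega>. cos (t * F n \<omega> + - (pi / 2))))" for n
  proof -
    have "integrable M (\<lambda>\<omega>. iexp (t * F n \<omega>))" by (rule integrable_iexp) auto
    then have "Re (CLINT \<omega>|M. iexp (t * F n \<omega>)) = expectation (\<lambda>\<omega>. Re (iexp (t * F n \<omega>)))"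
      "Im (CLINT \<omega>|M. iexp (t * F n \<omega>)) = expectation (\<lambda>\<omega>. Im (iexp (t * F n \<omega>)))"
      by simp_all
    moreover have "cos (x + - (pi / 2)) = sin x" for x :: real
      by (simp add: cos_sin_eq cos_diff)
    ultimately show ?thesis
      by (intro complex_eqI) (simp_all add: char_def integral_distr Re_exp Im_exp)
  qed
  have "(\<lambda>n. char (distr M borel (F n)) t) \<longlonglongrightarrow> Complex (cos 0 * exp (- t\<^sup>2 / 2)) (cos (- (pi / 2)) * exp (- t\<^sup>2 / 2))"
    unfolding char by (intro tendsto_Complex conv)
  also have "Complex (cos 0 * exp (- t\<^sup>2 / 2)) (cos (- (pi / 2)) * exp (- t\<^sup>2 / 2)) = char std_normal_distribution t"
    by (simp add: char_std_normal_distribution complex_eq_iff)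
  finally show "(\<lambda>n. char (distr M borel (F n)) t) \<longlonglongrightarrow> char std_normal_distribution t" .
qed

section \<open>Convergence of moments\<close>

text \<open>
  A bound \<open>B\<close> on the integrals of \<open>h\<^sup>2\<close> makes \<open>h\<close> uniformly integrable: truncating \<open>h\<close> at height \<open>k\<close>
  changes its integral by at most \<open>B / k\<close>, since \<open>h - min h k \<le> h\<^sup>2 / k\<close>.
\<close>
lemma weak_conv_integral_conv:
  fixes \<mu> :: "nat \<Rightarrow> real measure" and h :: "real \<Rightarrow> real"
  assumes \<mu>: "\<And>n. real_distribution (\<mu> n)" and \<nu>: "real_distribution \<nu>" and conv: "weak_conv_m \<mu> \<nu>"
    and h: "continuous_on UNIV h" "\<And>x. 0 \<le> h x"
    and int: "\<And>n. integrable (\<mu> n) (\<lambda>x. (h x)\<^sup>2)" "integrable \<nu> (\<lambda>x. (h x)\<^sup>2)"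
    and bound: "\<And>n. (\<integral>x. (h x)\<^sup>2 \<partial>\<mu> n) \<le> B"
  shows "(\<lambda>n. \<integral>x. h x \<partial>\<mu> n) \<longlonglongrightarrow> (\<integral>x. h x \<partial>\<nu>)"
proof -
  define B' where "B' = max 1 (max B (\<integral>x. (h x)\<^sup>2 \<partial>\<nu>))"
  have B': "B' \<ge> 1" by (simp add: B'_def)
  have [measurable]: "h \<in> borel_measurable borel" using h(1) by (rule borel_measurable_continuous_onI)
  have trunc: "\<bar>(\<integral>x. h x \<partial>\<rho>) - (\<integral>x. min (h x) k \<partial>\<rho>)\<bar> \<le> B' / k"
    if \<rho>: "real_distribution \<rho>" and i2: "integrable \<rho> (\<lambda>x. (h x)\<^sup>2)" "(\<integral>x. (h x)\<^sup>2 \<partial>\<rho>) \<le> B'" and k: "k > 0"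
    for \<rho> k
  proof -
    interpret real_distribution \<rho> by fact
    have ih: "integrable \<rho> h"
      by (rule square_integrable_imp_integrable[OF _ i2(1)]) simp
    have im: "integrable \<rho> (\<lambda>x. min (h x) k)"
      by (rule integrable_const_bound[of _ k]) (use h(2) k in \<open>auto simp: min_def\<close>)
    have "\<bar>(\<integral>x. h x \<partial>\<rho>) - (\<integral>x. min (h x) k \<partial>\<rho>)\<bar> = \<bar>\<integral>x. h x - min (h x) k \<partial>\<rho>\<bar>"
      using ih im by simp
    also have "\<dots> \<le> (\<integral>x. \<bar>h x - min (h x) k\<bar> \<partial>\<rho>)" by (rule integral_abs_bound)
    also have "\<dots> \<le> (\<integral>x. (h x)\<^sup>2 / k \<partial>\<rho>)"
    proof (rule integral_mono)
      fix x
      show "\<bar>h x - min (h x) k\<bar> \<le> (h x)\<^sup>2 / k"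
      proof (cases "h x \<le> k")
        case True then show ?thesis using k by simp
      next
        case False
        then have "k * h x \<le> (h x)\<^sup>2" using h(2)[of x] by (simp add: power2_eq_square mult_right_mono)
        then have "h x \<le> (h x)\<^sup>2 / k" using k by (simp add: pos_le_divide_eq mult.commute)
        then show ?thesis using False k by simp
      qed
    qed (use ih im i2 in auto)
    also have "\<dots> \<le> B' / k" using i2(2) k by (simp add: divide_right_mono)
    finally show ?thesis .
  qed
  show ?thesis
  proof (rule LIMSEQ_I)
    fix e :: real assume e: "e > 0"
    define k where "k = 4 * B' / e"
    have k: "k > 0" using B' e by (simp add: k_def)
    have Bk: "B' / k = e / 4" using B' e by (simp add: k_def)
    have "(\<lambda>n. \<integral>x. min (h x) k \<partial>\<mu> n) \<longlonglongrightarrow> (\<integral>x. min (h x) k \<partial>\<nu>)"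
    proof (rule weak_conv_imp_integral_bdd_continuous_conv[OF \<mu> \<nu> conv])
      show "isCont (\<lambda>x. min (h x) k) x" for x
        using h(1) by (intro continuous_intros) (auto simp: continuous_on_eq_continuous_at)
      show "norm (min (h x) k) \<le> k" for x using h(2)[of x] k by (auto simp: min_def)
    qed
    from LIMSEQ_D[OF this, of "e / 4"] e obtain N where
      N: "\<And>n. n \<ge> N \<Longrightarrow> norm ((\<integral>x. min (h x) k \<partial>\<mu> n) - (\<integral>x. min (h x) k \<partial>\<nu>)) < e / 4" by auto
    have "norm ((\<integral>x. h x \<partial>\<mu> n) - (\<integral>x. h x \<partial>\<nu>)) < e" if "n \<ge> N" for n
    proof -
      have "(\<integral>x. (h x)\<^sup>2 \<partial>\<mu> n) \<le> B'" using bound[of n] by (simp add: B'_def)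
      note 1 = trunc[OF \<mu> int(1) this k]
      have "(\<integral>x. (h x)\<^sup>2 \<partial>\<nu>) \<le> B'" by (simp add: B'_def)
      note 2 = trunc[OF \<nu> int(2) this k]
      show ?thesis using 1 2 N[OF that] e unfolding Bk real_norm_def by linarith
    qed
    then show "\<exists>N. \<forall>n\<ge>N. norm ((\<integral>x. h x \<partial>\<mu> n) - (\<integral>x. h x \<partial>\<nu>)) < e" by blast
  qed
qed

text \<open>
  A Paley--Zygmund argument. If the fourth moment of a law is at most \<open>C m\<^sup>2\<close> with \<open>C \<ge> 1\<close>, where
  \<open>m \<ge> k\<close> is its second moment, then it gives the bounded function \<open>min (x\<^sup>2 / k) 1\<close> an integral of at
  least \<open>3 / (4 C)\<close>. For large \<open>k\<close> the limit law gives it a smaller integral, so \<open>m \<ge> k\<close> fails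
  eventually.
\<close>
lemma weak_conv_second_moment_bounded:
  fixes \<mu> :: "nat \<Rightarrow> real measure"
  assumes \<mu>: "\<And>n. real_distribution (\<mu> n)" and \<nu>: "real_distribution \<nu>" and conv: "weak_conv_m \<mu> \<nu>"
    and int: "\<And>n. integrable (\<mu> n) (\<lambda>x. x ^ 4)" "integrable \<nu> (\<lambda>x. x ^ 2)"
    and kurt: "\<And>n. (\<integral>x. x ^ 4 \<partial>\<mu> n) \<le> B * (\<integral>x. x ^ 2 \<partial>\<mu> n)\<^sup>2"
  obtains A where "\<And>n. (\<integral>x. x ^ 2 \<partial>\<mu> n) \<le> A"
proof -
  define C where "C = max 1 B"
  define m where "m n = (\<integral>x. x ^ 2 \<partial>\<mu> n)" for n
  define m\<nu> where "m\<nu> = (\<integral>x. x ^ 2 \<partial>\<nu>)"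
  define k where "k = 2 * C * (m\<nu> + 1)"
  have C: "C \<ge> 1" by (simp add: C_def)
  have m\<nu>: "m\<nu> \<ge> 0" unfolding m\<nu>_def by (rule Bochner_Integration.integral_nonneg) simp
  have k: "k > 0" using C m\<nu> by (simp add: k_def)
  have kurt': "(\<integral>x. x ^ 4 \<partial>\<mu> n) \<le> C * (m n)\<^sup>2" for n
  proof -
    have "B * (m n)\<^sup>2 \<le> C * (m n)\<^sup>2" by (intro mult_right_mono) (auto simp: C_def)
    then show ?thesis using kurt[of n] by (simp add: m_def)
  qed
  have lower: "3 / (4 * C) \<le> (\<integral>x. min (x\<^sup>2 / k) 1 \<partial>\<mu> n)" if "m n \<ge> k" for n
  proof -
    interpret real_distribution "\<mu> n" by (rule \<mu>)
    have m0: "m n > 0" using that k by linarith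
    have i2: "integrable (\<mu> n) (\<lambda>x. x ^ 2)"
      by (rule square_integrable_imp_integrable) (use int(1)[of n] in \<open>auto simp: power_mult[symmetric]\<close>)
    have im: "integrable (\<mu> n) (\<lambda>x. min (x\<^sup>2 / k) 1)"
      by (rule integrable_const_bound[of _ 1]) (use k in \<open>auto simp: min_def\<close>)
    \<comment> \<open>the parabola \<open>a y - a\<^sup>2 y\<^sup>2 / 4\<close> in \<open>y = x\<^sup>2\<close> lies below 1 and below \<open>a y \<le> y / k\<close>; with this
      \<open>a\<close> its integral is at least \<open>a m - C a\<^sup>2 m\<^sup>2 / 4 = 3 / (4 C)\<close>\<close>
    define a where "a = 1 / (C * m n)"
    have "a \<le> 1 / k"
      unfolding a_def using k that C m0 mult_mono[of 1 C k "m n"] by (intro divide_left_mono) auto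
    have "a * m n - a\<^sup>2 / 4 * (C * (m n)\<^sup>2) \<le> a * m n - a\<^sup>2 / 4 * (\<integral>x. x ^ 4 \<partial>\<mu> n)"
      using kurt'[of n] by (intro diff_left_mono mult_left_mono) auto
    also have "\<dots> = (\<integral>x. a * x ^ 2 - a\<^sup>2 / 4 * x ^ 4 \<partial>\<mu> n)"
      using i2 int(1)[of n] by (simp add: m_def)
    also have "\<dots> \<le> (\<integral>x. min (x\<^sup>2 / k) 1 \<partial>\<mu> n)"
    proof (rule integral_mono[OF _ im])
      show "integrable (\<mu> n) (\<lambda>x. a * x ^ 2 - a\<^sup>2 / 4 * x ^ 4)" using i2 int(1)[of n] by simp
      fix x :: real
      have "a * x ^ 2 - a\<^sup>2 / 4 * x ^ 4 = 1 - (1 - a * x\<^sup>2 / 2)\<^sup>2"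
        by (simp add: power2_diff power_mult_distrib power_divide power_mult[symmetric])
      then have "a * x ^ 2 - a\<^sup>2 / 4 * x ^ 4 \<le> 1" by simp
      moreover have "a * x ^ 2 - a\<^sup>2 / 4 * x ^ 4 \<le> x\<^sup>2 / k"
      proof -
        have "a * x\<^sup>2 \<le> x\<^sup>2 / k" using mult_right_mono[OF \<open>a \<le> 1 / k\<close>, of "x\<^sup>2"] by simp
        moreover have "0 \<le> a\<^sup>2 / 4 * x ^ 4" by simp
        ultimately show ?thesis by linarith
      qed
      ultimately show "a * x ^ 2 - a\<^sup>2 / 4 * x ^ 4 \<le> min (x\<^sup>2 / k) 1" by simp
    qed
    also have "a * m n - a\<^sup>2 / 4 * (C * (m n)\<^sup>2) = 3 / (4 * C)"
      using m0 C by (simp add: a_def field_simps power2_eq_square)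
    finally show ?thesis .
  qed
  have upper: "(\<integral>x. min (x\<^sup>2 / k) 1 \<partial>\<nu>) < 3 / (4 * C)"
  proof -
    interpret real_distribution \<nu> by (rule \<nu>)
    have "(\<integral>x. min (x\<^sup>2 / k) 1 \<partial>\<nu>) \<le> (\<integral>x. x\<^sup>2 / k \<partial>\<nu>)"
    proof (rule integral_mono)
      show "integrable \<nu> (\<lambda>x. min (x\<^sup>2 / k) 1)"
        by (rule integrable_const_bound[of _ 1]) (use k in \<open>auto simp: min_def\<close>)
    qed (use int(2) in auto)
    also have "\<dots> = m\<nu> / k" by (simp add: m\<nu>_def)
    also have "\<dots> < 3 / (4 * C)" using C m\<nu> k by (simp add: k_def field_simps)
    finally show ?thesis .
  qed
  have "(\<lambda>n. \<integral>x. min (x\<^sup>2 / k) 1 \<partial>\<mu> n) \<longlonglongrightarrow> (\<integral>x. min (x\<^sup>2 / k) 1 \<partial>\<nu>)"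
  proof (rule weak_conv_imp_integral_bdd_continuous_conv[OF \<mu> \<nu> conv, where B = 1])
    show "isCont (\<lambda>x. min (x\<^sup>2 / k) 1) x" for x by (intro continuous_intros) (use k in simp)
    show "norm (min (x\<^sup>2 / k) 1) \<le> 1" for x using k by (simp add: min_def)
  qed
  from order_tendstoD(2)[OF this upper] obtain N where
    N: "\<And>n. n \<ge> N \<Longrightarrow> (\<integral>x. min (x\<^sup>2 / k) 1 \<partial>\<mu> n) < 3 / (4 * C)"
    unfolding eventually_sequentially by blast
  have late: "m n \<le> k" if "n \<ge> N" for n
    using N[OF that] lower[of n] by linarith
  have "m n \<le> Max (insert k (m ` {..<N}))" for n
  proof (cases "n < N")
    case False
    then show ?thesis using late[of n] by (subst Max_ge_iff) auto
  qed (auto intro: Max_ge)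
  then show thesis using that unfolding m_def by blast
qed

section \<open>Homogeneous sums in eigenspaces\<close>

lemma hypercontractive_even_moment:
  assumes "hypercontractive M H" "1 \<le> p"
  obtains C where "C \<ge> 0" "\<And>Y. Y \<in> H \<Longrightarrow> (\<integral>\<omega>. Y \<omega> ^ (2 * p) \<partial>M) \<le> C * (\<integral>\<omega>. (Y \<omega>)\<^sup>2 \<partial>M) ^ p"
proof -
  let ?r = "real (2 * p)"
  have r: "?r > 0" using assms(2) by simp
  have "2 \<le> ?r" using assms(2) by simp
  with assms(1) obtain C where
    C: "\<And>Y. Y \<in> H \<Longrightarrow> (\<integral>\<omega>. \<bar>Y \<omega>\<bar> powr ?r \<partial>M) powr (1 / ?r) \<le> C * sqrt (\<integral>\<omega>. (Y \<omega>)\<^sup>2 \<partial>M)"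
    unfolding hypercontractive_def by blast
  have pow: "\<bar>y\<bar> powr ?r = y ^ (2 * p)" for y :: real
  proof (cases "y = 0")
    case False
    then have "\<bar>y\<bar> powr ?r = \<bar>y\<bar> ^ (2 * p)" by (intro powr_realpow) simp
    then show ?thesis by (simp add: power_even_abs)
  qed (use assms(2) in simp)
  show thesis
  proof (rule that[of "C ^ (2 * p)"])
    show "0 \<le> C ^ (2 * p)" by simp
    fix Y assume "Y \<in> H"
    define m where "m = (\<integral>\<omega>. Y \<omega> ^ (2 * p) \<partial>M)"
    define m2 where "m2 = (\<integral>\<omega>. (Y \<omega>)\<^sup>2 \<partial>M)"
    have nonneg: "0 \<le> m" "0 \<le> m2"
      unfolding m_def m2_def by (intro Bochner_Integration.integral_nonneg; simp)+
    have le: "m powr (1 / ?r) \<le> C * sqrt m2"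
      using C[OF \<open>Y \<in> H\<close>] unfolding pow m_def m2_def .
    have "m = (m powr (1 / ?r)) powr ?r"
      using r nonneg by (simp add: powr_powr)
    also have "\<dots> = (m powr (1 / ?r)) ^ (2 * p)"
      using pow[of "m powr (1 / ?r)"] by simp
    also have "\<dots> \<le> (C * sqrt m2) ^ (2 * p)" using le by (intro power_mono) auto
    also have "\<dots> = C ^ (2 * p) * m2 ^ p"
      using nonneg by (simp add: power_mult_distrib power_mult)
    finally show "(\<integral>\<omega>. Y \<omega> ^ (2 * p) \<partial>M) \<le> C ^ (2 * p) * (\<integral>\<omega>. (Y \<omega>)\<^sup>2 \<partial>M) ^ p"
      unfolding m_def m2_def .
  qed
qed

text \<open>
  Orthogonality to constants and the vanishing mean leave a multiple of \<open>x\<close>, so products of first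
  orthogonal polynomials are the monomials of a multilinear form up to nonzero factors.
\<close>
lemma orthogonal_polynomial_1:
  assumes "orthogonal_polynomials \<mu> q" "stein_law \<mu> s v" "prob_space \<mu>"
  obtains \<beta> where "\<beta> \<noteq> 0" "q 1 = [:0, \<beta>:]"
proof -
  interpret prob_space \<mu> by fact
  have deg: "q k \<noteq> 0" "degree (q k) = k" for k
    using assms(1) by (auto simp: orthogonal_polynomials_def)
  obtain \<gamma> where q0: "q 0 = [:\<gamma>:]" using degree_eq_zeroE[OF deg(2)] by blast
  then have \<gamma>: "\<gamma> \<noteq> 0" using deg(1)[of 0] by auto
  obtain \<alpha> \<beta> where q1: "q 1 = [:\<alpha>, \<beta>:]" "\<beta> \<noteq> 0"
    using degree1_coeffs[of "q 1"] deg(2)[of 1] by metis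
  have "integrable \<mu> (\<lambda>x. x ^ 1)" using assms(2) unfolding stein_law_def by blast
  then have int: "integrable \<mu> (\<lambda>x. x)" by simp
  have "(\<integral>x. poly (q 0) x * poly (q 1) x \<partial>\<mu>) = 0"
    using assms(1) unfolding orthogonal_polynomials_def by simp
  then have "(\<integral>x. \<gamma> * (\<alpha> + \<beta> * x) \<partial>\<mu>) = 0" unfolding q0 q1 by (simp add: mult.commute)
  then have "\<alpha> = 0"
    using \<gamma> int stein_law_moments(1)[OF assms(2,3)] prob_space by simp
  then show thesis using that q1 by simp
qed

text \<open>
  The eigenspace consists of combinations over sets of functions, and different indices \<open>t\<close> may give the
  same function \<open>Z t\<close>; their coefficients are added up.
\<close>
lemma eigenspace_sum:
  assumes "finite T" "\<And>t. t \<in> T \<Longrightarrow> Z t \<in> eigen_products q X d"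
  shows "(\<lambda>\<omega>. \<Sum>t\<in>T. \<gamma> t * Z t \<omega>) \<in> eigenspace q X d"
  unfolding eigenspace_def
proof (intro CollectI exI conjI)
  show "finite (Z ` T)" "Z ` T \<subseteq> eigen_products q X d" using assms by auto
  show "(\<lambda>\<omega>. \<Sum>t\<in>T. \<gamma> t * Z t \<omega>) = (\<lambda>\<omega>. \<Sum>z\<in>Z ` T. (\<Sum>t\<in>{t \<in> T. Z t = z}. \<gamma> t) * z \<omega>)"
  proof
    fix \<omega>
    have "(\<Sum>t\<in>T. \<gamma> t * Z t \<omega>) = (\<Sum>z\<in>Z ` T. \<Sum>t\<in>{t \<in> T. Z t = z}. \<gamma> t * Z t \<omega>)"
      by (rule sum.image_gen[OF assms(1)])
    also have "\<dots> = (\<Sum>z\<in>Z ` T. (\<Sum>t\<in>{t \<in> T. Z t = z}. \<gamma> t) * z \<omega>)"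
      unfolding sum_distrib_right by (intro sum.cong refl) auto
    finally show "(\<Sum>t\<in>T. \<gamma> t * Z t \<omega>) = (\<Sum>z\<in>Z ` T. (\<Sum>t\<in>{t \<in> T. Z t = z}. \<gamma> t) * z \<omega>)" .
  qed
qed

lemma increasing_tuplesD:
  assumes "is \<in> increasing_tuples d"
  shows "distinct is" "card (set is) = d" "sorted_list_of_set (set is) = is"
  using assms
  by (auto simp: increasing_tuples_def strict_sorted_iff distinct_card
      sorted_list_of_set.idem_if_sorted_distinct)

lemma homogeneous_sum_in_eigenspace:
  assumes "finite {is \<in> increasing_tuples d. a is \<noteq> 0}" "1 \<le> d"
    and q: "\<And>i. \<beta> i \<noteq> 0" "\<And>i. q i 1 = [:0, \<beta> i:]"
  shows "(\<lambda>\<omega>. homogeneous_sum d a (\<lambda>i. X i \<omega>)) \<in> eigenspace q X d"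
proof -
  let ?T = "{is \<in> increasing_tuples d. a is \<noteq> 0}"
  define Z where "Z is \<omega> = (\<Prod>i\<in>set is. poly (q i 1) (X i \<omega>))" for "is" \<omega>
  have "(\<lambda>\<omega>. \<Sum>is\<in>?T. (a is / (\<Prod>i\<in>set is. \<beta> i)) * Z is \<omega>) \<in> eigenspace q X d"
  proof (rule eigenspace_sum[OF assms(1)])
    fix "is" assume "is \<in> ?T"
    then have "card (set is) = d" using increasing_tuplesD(2) by blast
    moreover from this have "set is \<noteq> {}" using assms(2) by auto
    ultimately show "Z is \<in> eigen_products q X d"
      unfolding eigen_products_def Z_def[abs_def]
      by (intro CollectI exI[of _ "set is"] exI[of _ "\<lambda>_. 1"]) simp
  qed
  also have "(\<lambda>\<omega>. \<Sum>is\<in>?T. (a is / (\<Prod>i\<in>set is. \<beta> i)) * Z is \<omega>)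
      = (\<lambda>\<omega>. homogeneous_sum d a (\<lambda>i. X i \<omega>))"
  proof
    fix \<omega>
    show "(\<Sum>is\<in>?T. (a is / (\<Prod>i\<in>set is. \<beta> i)) * Z is \<omega>) = homogeneous_sum d a (\<lambda>i. X i \<omega>)"
      unfolding homogeneous_sum_def
    proof (intro sum.cong refl)
      fix "is" assume "is \<in> ?T"
      then have "distinct is" using increasing_tuplesD(1) by blast
      then have "(\<Prod>i\<leftarrow>is. X i \<omega>) = (\<Prod>i\<in>set is. X i \<omega>)"
        by (simp add: prod.distinct_set_conv_list)
      moreover have "(\<Prod>i\<in>set is. \<beta> i) \<noteq> 0" using q(1) by simp
      moreover have "Z is \<omega> = (\<Prod>i\<in>set is. \<beta> i) * (\<Prod>i\<in>set is. X i \<omega>)"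
        unfolding Z_def q(2) by (simp add: prod.distrib mult.commute)
      ultimately show "(a is / (\<Prod>i\<in>set is. \<beta> i)) * Z is \<omega> = a is * (\<Prod>i\<leftarrow>is. X i \<omega>)"
        by simp
    qed
  qed
  finally show ?thesis .
qed

lemma homogeneous_sum_eq_sum_over_sets:
  "homogeneous_sum d a x
    = (\<Sum>I\<in>set ` {is \<in> increasing_tuples d. a is \<noteq> 0}. a (sorted_list_of_set I) * (\<Prod>i\<in>I. x i))"
proof -
  let ?T = "{is \<in> increasing_tuples d. a is \<noteq> 0}"
  have "inj_on set ?T"
    by (rule inj_on_inverseI[where g = sorted_list_of_set]) (use increasing_tuplesD(3) in auto)
  then show ?thesis
    unfolding homogeneous_sum_def
    by (simp add: sum.reindex, intro sum.cong refl)
       (auto simp: increasing_tuplesD prod.distinct_set_conv_list)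
qed

lemma std_normal_moment_2_4:
  "(\<integral>x. x ^ 2 \<partial>std_normal_distribution) = 1" "(\<integral>x. x ^ 4 \<partial>std_normal_distribution) = 3"
proof -
  interpret real_distribution std_normal_distribution by (rule real_dist_normal_dist)
  show 2: "(\<integral>x. x ^ 2 \<partial>std_normal_distribution) = 1"
    using std_normal_moments(2)[of 0] prob_space by (simp add: numeral_2_eq_2)
  have "Suc (Suc 2) = 4" by simp
  then show "(\<integral>x. x ^ 4 \<partial>std_normal_distribution) = 3"
    using std_normal_moments(2)[of 2] 2 by (simp del: power_Suc)
qed

section \<open>The fourth moment theorem\<close>

theorem theorem1p1:
  fixes M :: "'a measure" and X :: "nat \<Rightarrow> 'a \<Rightarrow> real"
    and q :: "nat \<Rightarrow> nat \<Rightarrow> real poly" and d :: nat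
    and a :: "nat \<Rightarrow> nat list \<Rightarrow> real"
  assumes "prob_space M"
    and "prob_space.indep_vars M (\<lambda>_. borel) X UNIV"
    and "\<And>i. distr M borel (X i) \<in> gaussian_gamma_laws"
    and "\<And>i. orthogonal_polynomials (distr M borel (X i)) (q i)"
    and "1 \<le> d"
    and "hypercontractive M (eigenspace q X d)"
    and "\<And>n. finite {is \<in> increasing_tuples d. a n is \<noteq> 0}"
  shows "weak_conv_m
           (\<lambda>n. distr M borel (\<lambda>\<omega>. homogeneous_sum d (a n) (\<lambda>i. X i \<omega>)))
           std_normal_distribution
         \<longleftrightarrow>
         (\<lambda>n. \<integral>\<omega>. homogeneous_sum d (a n) (\<lambda>i. X i \<omega>) ^ 2 \<partial>M) \<longlonglongrightarrow> 1 \<and>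
         (\<lambda>n. \<integral>\<omega>. homogeneous_sum d (a n) (\<lambda>i. X i \<omega>) ^ 4 \<partial>M) \<longlonglongrightarrow> 3"
proof -
  interpret prob_space M by fact
  note indep = assms(2) and d = assms(5)
  have X_meas [measurable]: "X i \<in> borel_measurable M" for i
    using indep by (auto simp: indep_vars_def)
  have "\<exists>s v. stein_law (distr M borel (X i)) s v" for i
    using gaussian_gamma_law_stein[OF assms(3)] by metis
  then obtain s v where stein: "\<And>i. stein_law (distr M borel (X i)) (s i) (v i)" by metis
  define S where "S n = set ` {is \<in> increasing_tuples d. a n is \<noteq> 0}" for n
  define c where "c n I = a n (sorted_list_of_set I)" for n I
  have form: "multilinear_form M X s v (\<Union>(S n)) (S n) d" for n
  proof
    show "finite (\<Union>(S n))" using assms(7)[of n] by (auto simp: S_def)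
    show "card I = d" if "I \<in> S n" for I using that increasing_tuplesD(2) by (auto simp: S_def)
  qed (use indep stein in auto)
  interpret mf: multilinear_form M X s v "\<Union>(S n)" "S n" "c n" d for n by (rule form)
  define F where "F n \<omega> = homogeneous_sum d (a n) (\<lambda>i. X i \<omega>)" for n \<omega>
  have F_eq: "F n \<omega> = mf.P n (\<lambda>i. X i \<omega>)" for n \<omega>
    unfolding F_def homogeneous_sum_eq_sum_over_sets mf.P_def by (simp add: S_def c_def)
  have am: "all_moments M (F n)" for n
    unfolding F_eq[abs_def] by (rule mf.all_moments_P)
  note [measurable] = all_moments_measurable[OF am]
  have int: "integrable M (\<lambda>\<omega>. F n \<omega> ^ k)" for n k
    by (intro all_moments_integrable all_moments_power am prob_space_axioms)
  have "weak_conv_m (\<lambda>n. distr M borel (F n)) std_normal_distribution"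
    if "(\<lambda>n. expectation (\<lambda>\<omega>. F n \<omega> ^ 2)) \<longlonglongrightarrow> 1" "(\<lambda>n. expectation (\<lambda>\<omega>. F n \<omega> ^ 4)) \<longlonglongrightarrow> 3"
  proof (rule stein_kernel_clt[OF am])
    let ?G = "\<lambda>n \<omega>. mf.\<Gamma> n (\<lambda>i. X i \<omega>) / real d"
    show "all_moments M (?G n)" for n
      using all_moments_mult[OF mf.all_moments_\<Gamma> all_moments_const[OF prob_space_axioms], of n "1 / real d"]
      by simp
    fix n t \<theta>
    have "real d * expectation (\<lambda>\<omega>. F n \<omega> * sin (t * F n \<omega> + \<theta>))
        = expectation (\<lambda>\<omega>. mf.\<Gamma> n (\<lambda>i. X i \<omega>) * (t * cos (t * F n \<omega> + \<theta>)))"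
      unfolding F_eq
    proof (rule mf.integration_by_parts)
      show "((\<lambda>x. sin (t * x + \<theta>)) has_real_derivative t * cos (t * x + \<theta>)) (at x)" for x
        by (auto intro!: derivative_eq_intros)
      show "cubic_growth (\<lambda>x. sin (t * x + \<theta>))" by (rule cubic_growth_bounded[of _ 1]) simp
      show "cubic_growth (\<lambda>x. t * cos (t * x + \<theta>))"
        by (rule cubic_growth_bounded[of _ "\<bar>t\<bar>"]) (simp add: abs_mult mult_left_le)
      show "continuous_on UNIV (\<lambda>x. t * cos (t * x + \<theta>))" by (intro continuous_intros)
    qed
    also have "\<dots> = t * expectation (\<lambda>\<omega>. mf.\<Gamma> n (\<lambda>i. X i \<omega>) * cos (t * F n \<omega> + \<theta>))"
      by (simp only: mult.left_commute[of _ t] integral_mult_right_zero)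
    finally show "expectation (\<lambda>\<omega>. F n \<omega> * sin (t * F n \<omega> + \<theta>)) = t * expectation (\<lambda>\<omega>. ?G n \<omega> * cos (t * F n \<omega> + \<theta>))"
      using d by (simp add: field_simps)
  next
    let ?u = "\<lambda>n. expectation (\<lambda>\<omega>. F n \<omega> ^ 4) / 3 - 2 * expectation (\<lambda>\<omega>. F n \<omega> ^ 2) + 1"
    show "(\<lambda>n. expectation (\<lambda>\<omega>. (mf.\<Gamma> n (\<lambda>i. X i \<omega>) / real d - 1)\<^sup>2)) \<longlonglongrightarrow> 0"
    proof (rule tendsto_sandwich[where f = "\<lambda>_. 0" and h = ?u])
      have "?u \<longlonglongrightarrow> 3 / 3 - 2 * 1 + 1" by (intro tendsto_intros that) simp
      then show "?u \<longlonglongrightarrow> 0" by simp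
      show "\<forall>\<^sub>F n in sequentially. expectation (\<lambda>\<omega>. (mf.\<Gamma> n (\<lambda>i. X i \<omega>) / real d - 1)\<^sup>2) \<le> ?u n"
        unfolding F_eq using mf.stein_kernel_variance[OF d] by simp
      show "\<forall>\<^sub>F n in sequentially. 0 \<le> expectation (\<lambda>\<omega>. (mf.\<Gamma> n (\<lambda>i. X i \<omega>) / real d - 1)\<^sup>2)"
        by (intro always_eventually allI Bochner_Integration.integral_nonneg) simp
    qed simp
  qed
  moreover have "(\<lambda>n. expectation (\<lambda>\<omega>. F n \<omega> ^ 2)) \<longlonglongrightarrow> 1 \<and> (\<lambda>n. expectation (\<lambda>\<omega>. F n \<omega> ^ 4)) \<longlonglongrightarrow> 3"
    if conv: "weak_conv_m (\<lambda>n. distr M borel (F n)) std_normal_distribution"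
  proof -
    let ?\<mu> = "\<lambda>n. distr M borel (F n)"
    have "\<exists>\<beta>. \<beta> \<noteq> 0 \<and> q i 1 = [:0, \<beta>:]" for i
      using orthogonal_polynomial_1[OF assms(4) stein prob_space_distr] X_meas by metis
    then obtain \<beta> where "\<And>i. \<beta> i \<noteq> 0" "\<And>i. q i 1 = [:0, \<beta> i:]" by metis
    then have F_in: "F n \<in> eigenspace q X d" for n
      unfolding F_def[abs_def] by (rule homogeneous_sum_in_eigenspace[OF assms(7) d])
    \<comment> \<open>the fourth moment serves twice, in the Paley--Zygmund bound and for the convergence of the
      second moments; the eighth makes the fourth powers uniformly integrable\<close>
    obtain C4 where C4: "C4 \<ge> 0" "\<And>Y. Y \<in> eigenspace q X d \<Longrightarrow> expectation (\<lambda>\<omega>. Y \<omega> ^ (2 * 2)) \<le> C4 * (expectation (\<lambda>\<omega>. (Y \<omega>)\<^sup>2)) ^ 2"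
      using hypercontractive_even_moment[OF assms(6), of 2] by auto
    obtain C8 where C8: "C8 \<ge> 0" "\<And>Y. Y \<in> eigenspace q X d \<Longrightarrow> expectation (\<lambda>\<omega>. Y \<omega> ^ (2 * 4)) \<le> C8 * (expectation (\<lambda>\<omega>. (Y \<omega>)\<^sup>2)) ^ 4"
      using hypercontractive_even_moment[OF assms(6), of 4] by auto
    have \<mu>: "real_distribution (?\<mu> n)" for n by (rule real_distribution_distr) simp
    note \<nu> = real_dist_normal_dist
    have int\<mu>: "integrable (?\<mu> n) (\<lambda>x. x ^ k)" for n k
      using int by (simp add: integrable_distr_eq)
    have mom\<mu>: "(\<integral>x. x ^ k \<partial>?\<mu> n) = expectation (\<lambda>\<omega>. F n \<omega> ^ k)" for n k
      by (simp add: integral_distr)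
    obtain A where A: "\<And>n. (\<integral>x. x ^ 2 \<partial>?\<mu> n) \<le> A"
    proof (rule weak_conv_second_moment_bounded[OF \<mu> \<nu> conv int\<mu> std_normal_moments(1)])
      show "(\<integral>x. x ^ 4 \<partial>?\<mu> n) \<le> C4 * (\<integral>x. x ^ 2 \<partial>?\<mu> n)\<^sup>2" for n
        unfolding mom\<mu> using C4(2)[OF F_in[of n]] by simp
    qed blast
    have m2: "0 \<le> expectation (\<lambda>\<omega>. F n \<omega> ^ 2)" "expectation (\<lambda>\<omega>. F n \<omega> ^ 2) \<le> A" for n
      using A[of n] unfolding mom\<mu> by (auto intro: Bochner_Integration.integral_nonneg)
    have b4: "expectation (\<lambda>\<omega>. F n \<omega> ^ 4) \<le> C4 * A\<^sup>2" for n
    proof -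
      have "C4 * (expectation (\<lambda>\<omega>. F n \<omega> ^ 2))\<^sup>2 \<le> C4 * A\<^sup>2"
        using C4(1) m2 by (intro mult_left_mono power_mono) auto
      then show ?thesis using C4(2)[OF F_in[of n]] by simp
    qed
    have b8: "expectation (\<lambda>\<omega>. F n \<omega> ^ 8) \<le> C8 * A ^ 4" for n
    proof -
      have "C8 * (expectation (\<lambda>\<omega>. F n \<omega> ^ 2)) ^ 4 \<le> C8 * A ^ 4"
        using C8(1) m2 by (intro mult_left_mono power_mono) auto
      then show ?thesis using C8(2)[OF F_in[of n]] by simp
    qed
    have "(\<lambda>n. \<integral>x. x ^ 2 \<partial>?\<mu> n) \<longlonglongrightarrow> (\<integral>x. x ^ 2 \<partial>std_normal_distribution)"
    proof (rule weak_conv_integral_conv[OF \<mu> \<nu> conv])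
      have sq: "(x ^ 2)\<^sup>2 = x ^ 4" for x :: real by (simp add: power_mult[symmetric])
      show "integrable (?\<mu> n) (\<lambda>x. (x ^ 2)\<^sup>2)" for n unfolding sq by (rule int\<mu>)
      show "integrable std_normal_distribution (\<lambda>x. (x ^ 2)\<^sup>2)" unfolding sq by (rule std_normal_moments(1))
      show "(\<integral>x. (x ^ 2)\<^sup>2 \<partial>?\<mu> n) \<le> C4 * A\<^sup>2" for n unfolding sq mom\<mu> by (rule b4)
    qed (auto intro: continuous_intros)
    moreover have "(\<lambda>n. \<integral>x. x ^ 4 \<partial>?\<mu> n) \<longlonglongrightarrow> (\<integral>x. x ^ 4 \<partial>std_normal_distribution)"
    proof (rule weak_conv_integral_conv[OF \<mu> \<nu> conv])
      have sq: "(x ^ 4)\<^sup>2 = x ^ 8" for x :: real by (simp add: power_mult[symmetric])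
      show "integrable (?\<mu> n) (\<lambda>x. (x ^ 4)\<^sup>2)" for n unfolding sq by (rule int\<mu>)
      show "integrable std_normal_distribution (\<lambda>x. (x ^ 4)\<^sup>2)" unfolding sq by (rule std_normal_moments(1))
      show "(\<integral>x. (x ^ 4)\<^sup>2 \<partial>?\<mu> n) \<le> C8 * A ^ 4" for n unfolding sq mom\<mu> by (rule b8)
    qed (auto intro: continuous_intros)
    ultimately show ?thesis unfolding mom\<mu> std_normal_moment_2_4 by blast
  qed
  ultimately show ?thesis unfolding F_def[abs_def] by blast
qed

end
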